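(* Let $(\Omega,\mathcal F,\mu)$ be a complete probability space with a filtration $(\mathcal F_n)_{n\ge 0}$ such that $\mathcal F=\bigvee_{n\ge0}\mathcal F_n$. Let $1<p_i<\infty$ $(i\in\mathbb N)$ with $\frac1p=\sum_{i=1}^\infty\frac1{p_i}$, $0<p<\infty$, let $\overrightarrow\omega=(\omega_1,\omega_2,\dots)$ be a sequence of weights satisfying the standing assumptions (A1)–(A4) listed in the context, and let $v$ be a weight. Suppose $\overrightarrow\omega\in RH_{\overrightarrow p}$. Then the following statements are equivalent: (1) There exists a positive constant $C$ such that $$\|\mathfrak M(\overrightarrow f)\|_{L^{p}(v)}\le C\prod_{i=1}^\infty\|f_i\|_{L^{p_i}(\omega_i)}$$ for all nonnegative $f_i\in L^{p_i}(\omega_i)$, $i\in\mathbb N$, with $\prod_{i=1}^\infty\|f_i\|_{L^{p_i}(\omega_i)}<\infty$, where $\overrightarrow f=(f_1,f_2,\dots)$. (2) There exists a positive constant $C$ such that $$\|\mathfrak M(\overrightarrow{g\sigma})\|_{L^{p}(v)}\le C\prod_{i=1}^\infty\|g_i\|_{L^{p_i}(\sigma_i)}$$ for all nonnegative $g_i\in L^{p_i}(\sigma_i)$, $i\in\mathbb N$, with $\prod_{i=1}^\infty\|g_i\|_{L^{p_i}(\sigma_i)}<\infty$, where $\overrightarrow{g\sigma}=(g_1\sigma_1,g_2\sigma_2,\dots)$. (3) $(v,\overrightarrow\omega)\in S_{\overrightarrow p}$, i.e. there exists a positive constant $C$ such that $$\Big(\int_{\{\tau<\infty\}}\mathfrak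 M(\overrightarrow{\sigma\chi_{\{\tau<\infty\}}})^{p}\,v\,d\mu\Big)^{\frac1p}\le C\prod_{i=1}^\infty|\{\tau<\infty\}|_{\sigma_i}^{\frac1{p_i}},\qquad\forall\tau\in\mathcal T,$$ where $\overrightarrow{\sigma\chi_{\{\tau<\infty\}}}=(\sigma_1\chi_{\{\tau<\infty\}},\sigma_2\chi_{\{\tau<\infty\}},\dots)$.
   Context: Conventions: $\mathbb N=\{1,2,\dots\}$; statements about functions are understood almost everywhere. For a sequence $(c_i)$ of finite nonnegative numbers, $\prod_{i=1}^\infty c_i$ denotes $\lim_{n\to\infty}\prod_{i=1}^n c_i$ when this limit exists in $[0,\infty)$ (the value $0$ is allowed); "$\prod_{i=1}^\infty c_i<\infty$" means that this finite limit exists. Infinite products of functions are taken pointwise a.e. Probability setting: $(\mathcal F_n)_{n\ge0}$ is an increasing sequence of sub-$\sigma$-fields of $\mathcal F$. $E_n(f)=E(f\mid\mathcal F_n)$. $\mathcal T$ is the set of all stopping times $\tau:\Omega\to\{0,1,2,\dots\}\cup\{\infty\}$. A weight is a random variable $\omega$ with $\omega>0$ and $E(\omega)<\infty$. For a weight $\omega$: $|B|_\omega=\int_B\omega\,d\mu$; $\|f\|_{L^q(\omega)}=(\int_\Omega|f|^q\omega\,d\mu)^{1/q}$. $\overrightarrow p=(p_1,p_2,\dots)$, $\frac1{p_i}+\frac1{p_i'}=1$, and $\sigma_i=\omega_i^{-\frac1{p_i-1}}=\omega_i^{1-p_i'}$. Standing assumptions: (A1) $\sigma_i\in L^1$ for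 all $i\in\mathbb N$; (A2) $\prod_{i=1}^\infty\|\sigma_i\|_{L^{p_i}(\omega_i)}<\infty$; (A3) for every $n\ge0$, $\prod_{i=1}^\infty E_n(\omega_i^{1-p_i'})^{1/p_i'}<\infty$ a.e.; (A4) $\prod_{i=1}^\infty\sigma_i^{1/p_i}>0$ a.e. Generalized Doob maximal operator: $\mathfrak M(\overrightarrow f)=\sup_{n\ge0}\prod_{i=1}^\infty|E_n(f_i)|$. (Under the standing assumptions and $\prod_i\|f_i\|_{L^{p_i}(\omega_i)}<\infty$ the products converge a.e., so this is well defined.) Reverse Hölder condition: $\overrightarrow\omega\in RH_{\overrightarrow p}$ means there is a positive constant $C$ such that $$\prod_{i=1}^\infty\Big(\int_{\{\tau<\infty\}}\sigma_i\,d\mu\Big)^{\frac p{p_i}}\le C\int_{\{\tau<\infty\}}\prod_{i=1}^\infty\sigma_i^{\frac p{p_i}}\,d\mu,\qquad\forall\tau\in\mathcal T.$$ *)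

theory Defs
  imports "HOL-Probability.Probability" "HOL-Library.Extended_Nat"
begin

text \<open>
  Sequences written with indices \<open>1, 2, \<dots>\<close> in the literature are indexed by
  \<open>nat\<close> from \<open>0\<close> here.

  The library's \<open>prodinf\<close> / \<open>convergent_prod\<close> treat products with limit \<open>0\<close>
  specially; here an infinite product is the plain limit of its partial products in
  \<open>[0,\<infinity>)\<close>, with the value \<open>0\<close> allowed.  All factors below are nonnegative, so
  \<open>iprod_finite c\<close> is the assertion written \<open>\<Prod>i c\<^sub>i < \<infinity>\<close>.
\<close>

definition iprod :: "(nat \<Rightarrow> real) \<Rightarrow> real" where
  "iprod c = lim (\<lambda>n. \<Prod>i<n. c i)"

definition iprod_finite :: "(nat \<Rightarrow> real) \<Rightarrow> bool" where
  "iprod_finite c \<longleftrightarrow> convergent (\<lambda>n. \<Prod>i<n. c i)"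

text \<open>Real powers on \<open>[0,\<infinity>]\<close>; only meant for exponents \<open>a > 0\<close>.\<close>

definition ennpowr :: "ennreal \<Rightarrow> real \<Rightarrow> ennreal" where
  "ennpowr x a = (if x = \<top> then \<top> else ennreal (enn2real x powr a))"

definition weight :: "'a measure \<Rightarrow> ('a \<Rightarrow> real) \<Rightarrow> bool" where
  "weight M w \<longleftrightarrow> integrable M w \<and> (AE x in M. w x > 0)"

definition wmeas :: "'a measure \<Rightarrow> ('a \<Rightarrow> real) \<Rightarrow> 'a set \<Rightarrow> real" where
  "wmeas M w B = (LINT x:B|M. w x)"

definition Lw :: "'a measure \<Rightarrow> real \<Rightarrow> ('a \<Rightarrow> real) \<Rightarrow> ('a \<Rightarrow> real) set" where
  "Lw M q w = {f \<in> borel_measurable M. integrable M (\<lambda>x. \<bar>f x\<bar> powr q * w x)}"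

definition Lw_norm :: "'a measure \<Rightarrow> real \<Rightarrow> ('a \<Rightarrow> real) \<Rightarrow> ('a \<Rightarrow> real) \<Rightarrow> real" where
  "Lw_norm M q w f = (LINT x|M. \<bar>f x\<bar> powr q * w x) powr (1 / q)"

text \<open>The same norm for \<open>[0,\<infinity>]\<close>-valued functions such as maximal functions; it may be \<open>\<infinity>\<close>.\<close>

definition eLw_norm :: "'a measure \<Rightarrow> real \<Rightarrow> ('a \<Rightarrow> real) \<Rightarrow> ('a \<Rightarrow> ennreal) \<Rightarrow> ennreal" where
  "eLw_norm M q w f = ennpowr (\<integral>\<^sup>+x. ennpowr (f x) q * ennreal (w x) \<partial>M) (1 / q)"

definition conj_exp :: "real \<Rightarrow> real" where
  "conj_exp q = q / (q - 1)"

definition sig :: "(nat \<Rightarrow> real) \<Rightarrow> (nat \<Rightarrow> 'a \<Rightarrow> real) \<Rightarrow> nat \<Rightarrow> 'a \<Rightarrow> real" where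
  "sig ps w i x = w i x powr (1 - conj_exp (ps i))"

text \<open>
  The library's \<open>stopping_time\<close> takes values in the index set of the filtration, hence does not
  allow the value \<open>\<infinity>\<close> for a filtration indexed by \<open>nat\<close>.
\<close>

definition ext_stopping_time :: "(nat \<Rightarrow> 'a measure) \<Rightarrow> ('a \<Rightarrow> enat) \<Rightarrow> bool" where
  "ext_stopping_time F \<tau> \<longleftrightarrow> (\<forall>n. Measurable.pred (F n) (\<lambda>x. \<tau> x \<le> enat n))"

definition fin_set :: "'a measure \<Rightarrow> ('a \<Rightarrow> enat) \<Rightarrow> 'a set" where
  "fin_set M \<tau> = {x \<in> space M. \<tau> x < \<infinity>}"

definition doob_max ::
  "'a measure \<Rightarrow> (nat \<Rightarrow> 'a measure) \<Rightarrow> (nat \<Rightarrow> 'a \<Rightarrow> real) \<Rightarrow> 'a \<Rightarrow> ennreal" where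
  "doob_max M F f x = (SUP n. ennreal (iprod (\<lambda>i. \<bar>real_cond_exp M (F n) (f i) x\<bar>)))"

definition RH ::
  "'a measure \<Rightarrow> (nat \<Rightarrow> 'a measure) \<Rightarrow> real \<Rightarrow> (nat \<Rightarrow> real) \<Rightarrow> (nat \<Rightarrow> 'a \<Rightarrow> real) \<Rightarrow> bool" where
  "RH M F p ps w \<longleftrightarrow>
    (\<exists>C>0. \<forall>\<tau>. ext_stopping_time F \<tau> \<longrightarrow>
      ennreal (iprod (\<lambda>i. (LINT x:fin_set M \<tau>|M. sig ps w i x) powr (p / ps i)))
      \<le> ennreal C * (\<integral>\<^sup>+x\<in>fin_set M \<tau>. ennreal (iprod (\<lambda>i. sig ps w i x powr (p / ps i))) \<partial>M))"

definition S_class ::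
  "'a measure \<Rightarrow> (nat \<Rightarrow> 'a measure) \<Rightarrow> real \<Rightarrow> (nat \<Rightarrow> real) \<Rightarrow> ('a \<Rightarrow> real)
    \<Rightarrow> (nat \<Rightarrow> 'a \<Rightarrow> real) \<Rightarrow> bool" where
  "S_class M F p ps v w \<longleftrightarrow>
    (\<exists>C>0. \<forall>\<tau>. ext_stopping_time F \<tau> \<longrightarrow>
      ennpowr (\<integral>\<^sup>+x\<in>fin_set M \<tau>.
          ennpowr (doob_max M F (\<lambda>i y. sig ps w i y * indicator (fin_set M \<tau>) y) x) p
            * ennreal (v x) \<partial>M) (1 / p)
      \<le> ennreal (C * iprod (\<lambda>i. wmeas M (sig ps w i) (fin_set M \<tau>) powr (1 / ps i))))"

end

theory Submission
  imports Defs
begin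

text \<open>
  Write \<open>\<sigma>\<^sub>i\<close> for the dual weights \<open>w\<^sub>i powr (1 - conj_exp p\<^sub>i)\<close>.  Since
  \<open>\<sigma>\<^sub>i\<^bsup>p\<^sub>i\<^esup> w\<^sub>i = \<sigma>\<^sub>i\<close>, the substitution \<open>f\<^sub>i = g\<^sub>i \<sigma>\<^sub>i\<close> is an isometry between the spaces in the
  first and the second statement, which are therefore equivalent.  Taking all \<open>g\<^sub>i\<close> to be the
  indicator of \<open>{\<tau> < \<infinity>}\<close> turns the second statement into the third.

  The substance is that the testing condition implies the second statement.  Under the measure
  \<open>\<sigma>\<^sub>i d\<mu>\<close> let \<open>X\<^sub>i\<^sub>,\<^sub>n\<close> be the conditional expectation of \<open>g\<^sub>i\<close>.  Then
  \<open>E\<^sub>n(g\<^sub>i \<sigma>\<^sub>i) = X\<^sub>i\<^sub>,\<^sub>n E\<^sub>n(\<sigma>\<^sub>i)\<close> (\<open>real_cond_exp_density\<close>), so the \<open>p\<close>-th power of the maximal function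
  is \<open>sup\<^sub>n a\<^sub>n U\<^sub>n\<close> with \<open>a\<^sub>n = (\<Prod>\<^sub>i E\<^sub>n(\<sigma>\<^sub>i))\<^sup>p\<close> and \<open>U\<^sub>n = (\<Prod>\<^sub>i X\<^sub>i\<^sub>,\<^sub>n)\<^sup>p\<close>.  Writing \<open>U\<^sub>n\<close> as the length of
  \<open>{0 < \<lambda> < U\<^sub>n}\<close> bounds the supremum by \<open>\<integral>\<^sub>0\<^sup>\<infinity> sup {a\<^sub>n. U\<^sub>n > \<lambda>} d\<lambda>\<close>.  For a fixed level \<open>\<lambda>\<close> let \<open>\<tau>\<close> be
  the first \<open>n\<close> with \<open>U\<^sub>n > \<lambda>\<close>.  On the \<open>\<F>\<^sub>n\<close>-measurable set \<open>{U\<^sub>n > \<lambda>}\<close>, which is part of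
  \<open>{\<tau> < \<infinity>}\<close>, the weights may be cut off to \<open>{\<tau> < \<infinity>}\<close> without changing \<open>E\<^sub>n(\<sigma>\<^sub>i)\<close>; hence the
  integrand at level \<open>\<lambda>\<close> is at most the \<open>p\<close>-th power of the maximal function in the testing condition
  for \<open>\<tau>\<close>.  That condition together with the reverse Hoelder inequality bounds its integral by a constant
  times \<open>\<integral>\<^bsub>{sup\<^sub>n U\<^sub>n > \<lambda>}\<^esub> \<Prod>\<^sub>i \<sigma>\<^sub>i\<^bsup>p/p\<^sub>i\<^esup>\<close>, and integrating over \<open>\<lambda>\<close> with the theorem of Fubini leaves
  \<open>\<integral> sup\<^sub>n U\<^sub>n \<Prod>\<^sub>i \<sigma>\<^sub>i\<^bsup>p/p\<^sub>i\<^esup>\<close> (\<open>testing_imp_bound\<close>).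

  This last integral carries no outer weight.  By the generalised inequality of Hoelder it is
  at most \<open>\<Prod>\<^sub>i (\<integral> (sup\<^sub>n X\<^sub>i\<^sub>,\<^sub>n)\<^bsup>p\<^sub>i\<^esup> \<sigma>\<^sub>i)\<^bsup>p/p\<^sub>i\<^esup>\<close>, and the maximal inequality of Doob applies to each factor
  (\<open>sup_prod_powr_bound\<close>).  The constants of infinitely many applications are multiplied here; the
  sharp constant \<open>p\<^sub>i / (p\<^sub>i - 1)\<close> is used because \<open>\<Prod>\<^sub>i p\<^sub>i / (p\<^sub>i - 1)\<close> is finite when
  \<open>\<Sum>\<^sub>i 1 / p\<^sub>i\<close> is, whereas the same additional factor greater than \<open>1\<close> in each step would make the product diverge.

  All infinite products have to be shown to converge.  This is made easy by first replacing
  \<open>|g\<^sub>i|\<close> by \<open>u\<^sub>i = max 1 (|g\<^sub>i| / t\<^sub>i)\<close>, where the constant \<open>t\<^sub>i\<close> is the \<open>L\<^bsup>p\<^sub>i\<^esup>(\<sigma>\<^sub>i)\<close>-norm of \<open>g\<^sub>i\<close> divided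
  by that of \<open>1\<close>.  The integral of \<open>u\<^sub>i\<^bsup>p\<^sub>i\<^esup>\<close> is at most twice that of \<open>1\<close>, which costs a total factor
  \<open>2\<^bsup>1/p\<^esup>\<close>, and the martingales of \<open>u\<^sub>i\<close> are at least \<open>1\<close>, so that their partial products increase.
\<close>

section \<open>Infinite products of nonnegative numbers\<close>

text \<open>
  The quotients \<open>c i / b i\<close> lie in \<open>[0,1]\<close>, so their partial products decrease and converge; the
  partial products of \<open>c\<close> are these times a convergent sequence.
\<close>

lemma prod_partial_dominated:
  fixes b c :: "nat \<Rightarrow> real"
  assumes c: "\<And>i. 0 \<le> c i" "\<And>i. c i \<le> b i"
    and b: "(\<lambda>n. \<Prod>i<n. b i) \<longlonglongrightarrow> L"
  shows "convergent (\<lambda>n. \<Prod>i<n. c i)" and "0 \<le> iprod c" and "iprod c \<le> L"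
proof -
  define r where "r i = c i / b i" for i
  have b0: "0 \<le> b i" for i using c[of i] by linarith
  have r: "0 \<le> r i" "r i \<le> 1" for i
    unfolding r_def using c[of i] b0[of i] by (auto simp: divide_le_eq_1)
  have cr: "c i = r i * b i" for i
    unfolding r_def using c[of i] by (cases "b i = 0") auto
  have "decseq (\<lambda>n. \<Prod>i<n. r i)"
    by (rule decseq_SucI) (simp add: mult_left_le r prod_nonneg)
  moreover have "0 \<le> (\<Prod>i<n. r i)" for n by (simp add: r prod_nonneg)
  ultimately have "convergent (\<lambda>n. \<Prod>i<n. r i)"
    using decseq_convergent[of _ 0] by (metis convergentI)
  then obtain R where "(\<lambda>n. \<Prod>i<n. r i) \<longlonglongrightarrow> R" by (auto simp: convergent_def)
  from tendsto_mult[OF this b] have "(\<lambda>n. \<Prod>i<n. c i) \<longlonglongrightarrow> R * L"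
    by (simp add: cr prod.distrib)
  then show conv: "convergent (\<lambda>n. \<Prod>i<n. c i)" by (rule convergentI)
  then have lim: "(\<lambda>n. \<Prod>i<n. c i) \<longlonglongrightarrow> iprod c"
    unfolding iprod_def by (simp add: convergent_LIMSEQ_iff)
  show "0 \<le> iprod c"
    by (rule LIMSEQ_le_const[OF lim]) (auto intro!: prod_nonneg c)
  show "iprod c \<le> L"
    by (rule LIMSEQ_le[OF lim b]) (auto intro!: prod_mono c)
qed

lemma iprod_lim: "convergent (\<lambda>n. \<Prod>i<n. c i) \<Longrightarrow> (\<lambda>n. \<Prod>i<n. c i) \<longlonglongrightarrow> iprod c"
  unfolding iprod_def by (simp add: convergent_LIMSEQ_iff)

lemma iprod_eqI: "(\<lambda>n. \<Prod>i<n. c i) \<longlonglongrightarrow> L \<Longrightarrow> iprod c = L"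
  unfolding iprod_def by (rule limI)

lemma iprod_powr:
  fixes c :: "nat \<Rightarrow> real"
  assumes "\<And>i. 0 \<le> c i" "(\<lambda>n. \<Prod>i<n. c i) \<longlonglongrightarrow> L" "0 < a"
  shows "(\<lambda>n. \<Prod>i<n. c i powr a) \<longlonglongrightarrow> L powr a"
proof -
  have "(\<lambda>n. (\<Prod>i<n. c i) powr a) \<longlonglongrightarrow> L powr a"
    by (intro tendsto_powr2[OF assms(2) tendsto_const]) (auto intro!: always_eventually prod_nonneg assms)
  then show ?thesis by (simp add: prod_powr_distrib assms)
qed

text \<open>
  Only large factors could prevent convergence.  Replacing \<open>y i\<close> by \<open>max 1 (y i)\<close> gives an
  increasing sequence of partial products that \<open>exp (\<Sum>i. \<alpha> i * y i)\<close> bounds, and domination does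
  the rest.
\<close>

lemma convergent_prod_powr_of_summable:
  fixes y \<alpha> :: "nat \<Rightarrow> real"
  assumes y: "\<And>i. 0 \<le> y i" and \<alpha>: "\<And>i. 0 \<le> \<alpha> i" and s: "summable (\<lambda>i. \<alpha> i * y i)"
  shows "convergent (\<lambda>n. \<Prod>i<n. y i powr \<alpha> i)"
proof -
  define b where "b i = max 1 (y i) powr \<alpha> i" for i
  have b1: "1 \<le> b i" for i unfolding b_def by (simp add: ge_one_powr_ge_zero \<alpha>)
  have bexp: "b i \<le> exp (\<alpha> i * y i)" for i
  proof -
    \<comment> \<open>Here \<open>ln z \<le> z - 1\<close> is weakened by \<open>1\<close> so that it also covers \<open>y i < 1\<close>.\<close>
    have "ln (max 1 (y i)) \<le> y i"
      using ln_le_minus_one[of "y i"] y[of i] by (cases "1 \<le> y i") (auto simp: max_def)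
    then show ?thesis unfolding b_def powr_def by (simp add: mult_left_mono \<alpha>)
  qed
  have "(\<Prod>i<n. b i) \<le> exp (suminf (\<lambda>i. \<alpha> i * y i))" for n
  proof -
    have "(\<Prod>i<n. b i) \<le> (\<Prod>i<n. exp (\<alpha> i * y i))"
      by (intro prod_mono conjI bexp) (use b1 in \<open>auto intro: order_trans[OF zero_le_one]\<close>)
    also have "\<dots> = exp (\<Sum>i<n. \<alpha> i * y i)" by (simp add: exp_sum)
    also have "\<dots> \<le> exp (suminf (\<lambda>i. \<alpha> i * y i))"
      using s by (simp add: sum_le_suminf \<alpha> y)
    finally show ?thesis .
  qed
  moreover have "incseq (\<lambda>n. \<Prod>i<n. b i)"
  proof (rule incseq_SucI)
    fix n
    have "0 \<le> (\<Prod>i<n. b i)" by (intro prod_nonneg order_trans[OF zero_le_one b1])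
    then show "(\<Prod>i<n. b i) \<le> (\<Prod>i<Suc n. b i)"
      using mult_left_mono[OF b1[of n], of "\<Prod>i<n. b i"] by (simp add: mult.commute)
  qed
  ultimately obtain L where "(\<lambda>n. \<Prod>i<n. b i) \<longlonglongrightarrow> L"
    using incseq_convergent by metis
  then show ?thesis
    by (rule prod_partial_dominated(1)[rotated 2])
      (auto simp: b_def intro!: powr_mono2 \<alpha> y)
qed

text \<open>
  The factors are \<open>1 + 1 / (q i - 1)\<close>, and \<open>1 / (q i - 1) \<le> 2 / q i\<close> as soon as \<open>q i \<ge> 2\<close>.
\<close>

lemma prod_conj_exp_bounded:
  fixes q :: "nat \<Rightarrow> real"
  assumes q: "\<And>i. 1 < q i" and s: "summable (\<lambda>i. 1 / q i)"
  obtains B where "0 < B" "\<And>N. (\<Prod>i<N. q i / (q i - 1)) \<le> B"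
proof
  let ?a = "\<lambda>i. 1 / (q i - 1)"
  have "(\<lambda>i. 1 / q i) \<longlonglongrightarrow> 0" using s by (rule summable_LIMSEQ_zero)
  then have "\<forall>\<^sub>F i in sequentially. 1 / q i < 1 / 2" by (rule order_tendstoD) simp
  then have "\<forall>\<^sub>F i in sequentially. norm (?a i) \<le> 2 * (1 / q i)"
  proof eventually_elim
    case (elim i)
    then have "2 < q i" using q[of i] by (simp add: field_simps)
    then show ?case by (simp add: field_simps)
  qed
  then have "summable ?a"
    by (rule summable_comparison_test_ev) (use s in \<open>rule summable_mult\<close>)
  show "0 < exp (suminf ?a)" by simp
  show "(\<Prod>i<N. q i / (q i - 1)) \<le> exp (suminf ?a)" for N
  proof -
    have "(\<Prod>i<N. q i / (q i - 1)) \<le> (\<Prod>i<N. exp (?a i))"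
    proof (intro prod_mono conjI)
      fix i
      have "q i / (q i - 1) = 1 + ?a i" using q[of i] by (simp add: field_simps)
      then show "q i / (q i - 1) \<le> exp (?a i)" using exp_ge_add_one_self by simp
      show "0 \<le> q i / (q i - 1)" using q[of i] by simp
    qed
    also have "\<dots> = exp (\<Sum>i<N. ?a i)" by (simp add: exp_sum)
    also have "\<dots> \<le> exp (suminf ?a)"
      using \<open>summable ?a\<close> q by (simp add: sum_le_suminf less_imp_le)
    finally show ?thesis .
  qed
qed

section \<open>Inequalities for integrals of products\<close>

text \<open>
  The missing weight \<open>1 - sum \<alpha> I\<close> is carried by an additional point with value \<open>1\<close>.  With \<open>t\<close> the
  right-hand side, the tangent inequality \<open>ln (z / t) \<le> z / t - 1\<close> is averaged over all points.
\<close>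

lemma weighted_AM_GM:
  fixes y \<alpha> :: "'i \<Rightarrow> real"
  assumes I: "finite I" and y: "\<And>i. i \<in> I \<Longrightarrow> 0 \<le> y i" and \<alpha>: "\<And>i. i \<in> I \<Longrightarrow> 0 \<le> \<alpha> i"
    and le1: "sum \<alpha> I \<le> 1"
  shows "(\<Prod>i\<in>I. y i powr \<alpha> i) \<le> (\<Sum>i\<in>I. \<alpha> i * y i) + (1 - sum \<alpha> I)"
proof (cases "\<exists>i\<in>I. y i = 0")
  case True
  then have "(\<Prod>i\<in>I. y i powr \<alpha> i) = 0" using I by (auto simp: prod_zero_iff)
  moreover have "0 \<le> (\<Sum>i\<in>I. \<alpha> i * y i)" by (intro sum_nonneg mult_nonneg_nonneg y \<alpha>)
  ultimately show ?thesis using le1 by linarith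
next
  case False
  with y have pos: "0 < y i" if "i \<in> I" for i using that by (metis order_le_less)
  define t where "t = (\<Sum>i\<in>I. \<alpha> i * y i) + (1 - sum \<alpha> I)"
  have "t > 0"
  proof (cases "sum \<alpha> I = 1")
    case True
    then obtain j where "j \<in> I" "\<alpha> j \<noteq> 0" by (metis sum.neutral zero_neq_one)
    then have "0 < \<alpha> j * y j" using pos[of j] \<alpha>[of j] by simp
    then have "0 < (\<Sum>i\<in>I. \<alpha> i * y i)"
      using \<open>j \<in> I\<close> by (intro sum_pos2[OF I]) (auto intro: mult_nonneg_nonneg y \<alpha>)
    then show ?thesis using True unfolding t_def by simp
  next
    case False
    moreover have "0 \<le> (\<Sum>i\<in>I. \<alpha> i * y i)" by (intro sum_nonneg mult_nonneg_nonneg y \<alpha>)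
    ultimately show ?thesis using le1 unfolding t_def by simp
  qed
  have ln_le: "ln z - ln t \<le> z / t - 1" if "0 < z" for z
    using ln_le_minus_one[of "z / t"] that \<open>t > 0\<close> by (simp add: ln_div)
  have "(\<Sum>i\<in>I. \<alpha> i * (ln (y i) - ln t)) \<le> (\<Sum>i\<in>I. \<alpha> i * (y i / t - 1))"
    by (intro sum_mono mult_left_mono ln_le pos \<alpha>)
  moreover have "(1 - sum \<alpha> I) * (ln 1 - ln t) \<le> (1 - sum \<alpha> I) * (1 / t - 1)"
    by (intro mult_left_mono ln_le) (use le1 in auto)
  moreover have "(\<Sum>i\<in>I. \<alpha> i * (y i / t - 1)) + (1 - sum \<alpha> I) * (1 / t - 1) = t / t - 1"
  proof -
    have "(\<Sum>i\<in>I. \<alpha> i * (y i / t - 1)) = (\<Sum>i\<in>I. \<alpha> i * y i) / t - sum \<alpha> I"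
      by (simp add: right_diff_distrib sum_subtractf sum_divide_distrib)
    then have "(\<Sum>i\<in>I. \<alpha> i * (y i / t - 1)) + (1 - sum \<alpha> I) * (1 / t - 1)
        = ((\<Sum>i\<in>I. \<alpha> i * y i) + (1 - sum \<alpha> I)) / t - 1"
      by (simp add: algebra_simps add_divide_distrib diff_divide_distrib)
    then show ?thesis by (simp only: flip: t_def)
  qed
  ultimately have "(\<Sum>i\<in>I. \<alpha> i * ln (y i)) \<le> ln t"
    using \<open>t > 0\<close>
    by (simp add: right_diff_distrib sum_subtractf algebra_simps flip: sum_distrib_left sum_distrib_right)
  moreover have "(\<Prod>i\<in>I. y i powr \<alpha> i) = exp (\<Sum>i\<in>I. \<alpha> i * ln (y i))"
    unfolding exp_sum[OF I] by (intro prod.cong refl) (use pos in \<open>force simp: powr_def\<close>)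
  ultimately have "(\<Prod>i\<in>I. y i powr \<alpha> i) \<le> exp (ln t)" by simp
  then show ?thesis using \<open>t > 0\<close> by (simp add: t_def)
qed

text \<open>
  After normalisation by \<open>c i\<close> the weighted arithmetic-geometric inequality holds pointwise and is
  integrated.  Exponents with sum below \<open>1\<close> are covered because the total mass is \<open>1\<close>; this is
  what makes the bound usable for the partial products of an infinite family.
\<close>

lemma (in prob_space) Holder_prod_le:
  fixes f :: "nat \<Rightarrow> 'a \<Rightarrow> real"
  assumes [measurable]: "\<And>i. f i \<in> borel_measurable M"
    and f: "\<And>i x. 0 \<le> f i x" and c: "\<And>i. 0 < c i" and \<alpha>: "\<And>i. 0 \<le> \<alpha> i"
    and le1: "(\<Sum>i<N. \<alpha> i) \<le> 1" and int: "\<And>i. (\<integral>\<^sup>+x. ennreal (f i x) \<partial>M) \<le> ennreal (c i)"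
  shows "(\<integral>\<^sup>+x. ennreal (\<Prod>i<N. f i x powr \<alpha> i) \<partial>M) \<le> ennreal (\<Prod>i<N. c i powr \<alpha> i)"
proof -
  define C where "C = (\<Prod>i<N. c i powr \<alpha> i)"
  have C: "0 < C" unfolding C_def by (intro prod_pos) (simp add: c less_imp_neq[symmetric])
  define A where "A = 1 - (\<Sum>i<N. \<alpha> i)"
  have A: "0 \<le> A" using le1 by (simp add: A_def)
  have "ennreal (\<Prod>i<N. f i x powr \<alpha> i)
      \<le> ennreal C * ((\<Sum>i<N. ennreal (\<alpha> i / c i) * ennreal (f i x)) + ennreal A)" for x
  proof -
    have "(\<Prod>i<N. f i x powr \<alpha> i) = C * (\<Prod>i<N. (f i x / c i) powr \<alpha> i)"
      unfolding C_def prod.distrib[symmetric]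
      by (intro prod.cong refl) (simp add: powr_divide f c less_imp_le less_imp_neq[symmetric])
    also have "\<dots> \<le> C * ((\<Sum>i<N. \<alpha> i * (f i x / c i)) + A)"
      unfolding A_def using C
      by (intro mult_left_mono weighted_AM_GM) (auto intro!: divide_nonneg_pos f c \<alpha> le1)
    finally have "ennreal (\<Prod>i<N. f i x powr \<alpha> i) \<le> ennreal (C * ((\<Sum>i<N. \<alpha> i / c i * f i x) + A))"
      by (simp add: ennreal_leI)
    also have "\<dots> = ennreal C * ((\<Sum>i<N. ennreal (\<alpha> i / c i) * ennreal (f i x)) + ennreal A)"
      using C A by (simp add: ennreal_mult' ennreal_plus sum_nonneg f c \<alpha> less_imp_le
          flip: ennreal_mult'' sum_ennreal)
    finally show ?thesis .
  qed
  then have "(\<integral>\<^sup>+x. ennreal (\<Prod>i<N. f i x powr \<alpha> i) \<partial>M)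
      \<le> (\<integral>\<^sup>+x. ennreal C * ((\<Sum>i<N. ennreal (\<alpha> i / c i) * ennreal (f i x)) + ennreal A) \<partial>M)"
    by (intro nn_integral_mono)
  also have "\<dots> = ennreal C * ((\<Sum>i<N. ennreal (\<alpha> i / c i) * (\<integral>\<^sup>+x. ennreal (f i x) \<partial>M)) + ennreal A)"
    by (simp add: nn_integral_cmult nn_integral_add nn_integral_sum emeasure_space_1)
  also have "\<dots> \<le> ennreal C * ((\<Sum>i<N. ennreal (\<alpha> i / c i) * ennreal (c i)) + ennreal A)"
    by (intro mult_left_mono add_mono sum_mono int order_refl) auto
  also have "(\<Sum>i<N. ennreal (\<alpha> i / c i) * ennreal (c i)) = (\<Sum>i<N. ennreal (\<alpha> i))"
    by (intro sum.cong refl) (metis c ennreal_mult' less_imp_le less_numeral_extra(3) nonzero_eq_divide_eq ennreal_mult'')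
  also have "\<dots> + ennreal A = ennreal ((\<Sum>i<N. \<alpha> i) + A)"
    using A by (simp add: \<alpha> sum_nonneg)
  also have "\<dots> = 1" by (simp add: A_def)
  finally show ?thesis by (simp add: C_def)
qed

text \<open>
  The lemma of Fatou in the form in which limits are taken below.
\<close>

lemma nn_integral_le_of_tendsto:
  fixes f :: "nat \<Rightarrow> 'a \<Rightarrow> ennreal"
  assumes [measurable]: "\<And>n. f n \<in> borel_measurable M"
    and lim: "AE x in M. (\<lambda>n. f n x) \<longlonglongrightarrow> g x"
    and le: "\<And>n. (\<integral>\<^sup>+x. f n x \<partial>M) \<le> c n" and c: "c \<longlonglongrightarrow> C"
  shows "(\<integral>\<^sup>+x. g x \<partial>M) \<le> C"
proof -
  have "(\<integral>\<^sup>+x. g x \<partial>M) = (\<integral>\<^sup>+x. liminf (\<lambda>n. f n x) \<partial>M)"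
    by (intro nn_integral_cong_AE, use lim in eventually_elim)
      (simp add: lim_imp_Liminf)
  also have "\<dots> \<le> liminf (\<lambda>n. \<integral>\<^sup>+x. f n x \<partial>M)"
    by (rule nn_integral_liminf) simp
  also have "\<dots> \<le> liminf c" by (intro Liminf_mono) (simp add: le)
  also have "\<dots> = C" using c by (simp add: lim_imp_Liminf)
  finally show ?thesis .
qed

text \<open>
  The layer-cake formula at one point.
\<close>

lemma nn_integral_indicator_less:
  "(\<integral>\<^sup>+l. indicator {l. 0 < l \<and> ennreal l < U} l \<partial>lborel) = (U :: ennreal)"
proof (cases U)
  case (real r)
  then have "{l. 0 < l \<and> ennreal l < U} = {0<..<r}"
    by (auto simp: ennreal_less_iff)
  then show ?thesis using real by simp
next
  case top
  have "{l. 0 < l \<and> ennreal l < U} = {0<..}" using top by auto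
  moreover have "emeasure lborel {0::real<..} = \<infinity>" 
  proof (rule ccontr)
    assume "emeasure lborel {0::real<..} \<noteq> \<infinity>"
    then obtain r where r: "0 \<le> r" "emeasure lborel {0::real<..} = ennreal r"
      by (cases "emeasure lborel {0::real<..}") auto
    have "emeasure lborel {0<..<r+1} \<le> emeasure lborel {0::real<..}"
      by (rule emeasure_mono) auto
    then show False using r by simp
  qed
  ultimately show ?thesis using top by simp
qed

section \<open>Powers of extended nonnegative numbers\<close>

lemma ennpowr_ennreal: "0 \<le> x \<Longrightarrow> ennpowr (ennreal x) a = ennreal (x powr a)"
  by (simp add: ennpowr_def)

lemma ennpowr_mono: "x \<le> y \<Longrightarrow> 0 \<le> a \<Longrightarrow> ennpowr x a \<le> ennpowr y a"
  by (cases x; cases y) (auto simp: ennpowr_def ennreal_le_iff2 powr_mono2 top_unique)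

lemma ennpowr_ennpowr: "0 < a \<Longrightarrow> ennpowr (ennpowr x a) (1 / a) = x"
  by (cases x) (auto simp: ennpowr_def powr_powr)

lemma ennpowr_ennpowr': "0 < a \<Longrightarrow> ennpowr (ennpowr x (1 / a)) a = x"
  by (cases x) (auto simp: ennpowr_def powr_powr)

text \<open>
  Taking \<open>1/a\<close>-th powers moves the supremum out of the power.
\<close>

lemma ennpowr_SUP_le:
  assumes "0 < a" "\<And>n. ennpowr (f n) a \<le> y"
  shows "ennpowr (SUP n. f n) a \<le> y"
proof -
  have "f n \<le> ennpowr y (1 / a)" for n
    using ennpowr_mono[OF assms(2)[of n], of "1 / a"] assms(1) by (simp add: ennpowr_ennpowr)
  then have "(SUP n. f n) \<le> ennpowr y (1 / a)" by (rule SUP_least)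
  from ennpowr_mono[OF this, of a] show ?thesis using assms(1) by (simp add: ennpowr_ennpowr')
qed

section \<open>Conditional expectations and stopping times\<close>

lemma sigma_finite_subalgebraI:
  assumes "finite_measure M" "subalgebra M G"
  shows "sigma_finite_subalgebra M G"
  by (intro finite_measure_subalgebra_is_sigma_finite finite_measure_subalgebra.intro
      finite_measure_subalgebra_axioms.intro assms)

text \<open>
  Bayes' rule: both sides have the same integral over each \<open>A\<close> in \<open>G\<close>, because integrating a
  \<open>G\<close>-measurable function against \<open>s\<close> or against its conditional expectation is the same.
\<close>

lemma real_cond_exp_density:
  fixes u s :: "'a \<Rightarrow> real"
  assumes M: "finite_measure M" and sub: "subalgebra M G"
    and s: "integrable M s" "\<And>x. 0 \<le> s x"
    and u [measurable]: "u \<in> borel_measurable M" and us: "integrable M (\<lambda>x. u x * s x)"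
  shows "AE x in M. real_cond_exp M G (\<lambda>x. u x * s x) x
    = real_cond_exp (density M s) G u x * real_cond_exp M G s x"
proof -
  interpret finite_measure M by fact
  have [measurable]: "s \<in> borel_measurable M" using s(1) by auto
  let ?N = "density M (\<lambda>x. ennreal (s x))"
  have subN: "subalgebra ?N G" using sub by (simp add: subalgebra_def)
  have "finite_measure ?N"
    using s by (intro finite_measureI) (simp add: emeasure_density nn_integral_eq_integral)
  then interpret N: sigma_finite_subalgebra ?N G
    by (rule sigma_finite_subalgebraI[OF _ subN])
  interpret sigma_finite_subalgebra M G
    by (rule sigma_finite_subalgebraI[OF M sub])
  define X where "X = real_cond_exp ?N G u"
  have XG [measurable]: "X \<in> borel_measurable G" unfolding X_def by simp
  have [measurable]: "X \<in> borel_measurable M" using XG sub measurable_from_subalg by blast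
  have uN: "integrable ?N u"
    using us s by (subst integrable_density) (auto simp: mult.commute)
  then have "integrable ?N X" unfolding X_def by (rule N.real_cond_exp_int(1))
  then have Xs: "integrable M (\<lambda>x. X x * s x)"
    using s by (subst (asm) integrable_density) (auto simp: mult.commute)
  show ?thesis unfolding X_def[symmetric]
  proof (rule real_cond_exp_charact[OF _ us])
    show "integrable M (\<lambda>x. X x * real_cond_exp M G s x)"
      by (rule real_cond_exp_intg(1)[OF Xs]) auto
    show "(\<lambda>x. X x * real_cond_exp M G s x) \<in> borel_measurable G" by measurable
    fix A assume A [measurable]: "A \<in> sets G"
    then have AM [measurable]: "A \<in> sets M" using sub by (auto simp: subalgebra_def)
    have iXs: "integrable M (\<lambda>x. indicator A x * X x * s x)"
      using integrable_mult_indicator[OF AM Xs] by (simp add: mult.assoc)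
    have "(\<integral>x\<in>A. u x * s x \<partial>M) = (\<integral>x. indicator A x * u x \<partial>?N)"
      using s by (subst integral_density) (auto simp: set_lebesgue_integral_def mult_ac)
    also have "\<dots> = (\<integral>x. indicator A x * X x \<partial>?N)"
      using N.real_cond_exp_intA[OF uN A] by (simp add: X_def set_lebesgue_integral_def)
    also have "\<dots> = (\<integral>x. indicator A x * X x * s x \<partial>M)"
      using s by (subst integral_density) (auto simp: mult_ac)
    also have "\<dots> = (\<integral>x. indicator A x * X x * real_cond_exp M G s x \<partial>M)"
      by (rule real_cond_exp_intg(2)[symmetric, OF iXs]) auto
    finally show "(\<integral>x\<in>A. u x * s x \<partial>M) = (\<integral>x\<in>A. X x * real_cond_exp M G s x \<partial>M)"
      by (simp add: set_lebesgue_integral_def mult.assoc)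
  qed
qed

text \<open>
  The first entry time is at most \<open>n\<close> exactly if \<open>P k\<close> holds for some \<open>k \<le> n\<close>.
\<close>

lemma ext_stopping_time_first_entry:
  fixes F :: "nat \<Rightarrow> 'a measure"
  assumes sub: "\<And>m n. m \<le> n \<Longrightarrow> subalgebra (F n) (F m)"
    and P: "\<And>n. Measurable.pred (F n) (P n)"
  shows "ext_stopping_time F (\<lambda>x. if \<exists>n. P n x then enat (LEAST n. P n x) else \<infinity>)"
  unfolding ext_stopping_time_def
proof
  fix n
  have eq: "(if \<exists>n. P n x then enat (LEAST n. P n x) else \<infinity>) \<le> enat n \<longleftrightarrow> (\<exists>k\<in>{..n}. P k x)" for x
  proof
    assume "(if \<exists>n. P n x then enat (LEAST n. P n x) else \<infinity>) \<le> enat n"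
    then show "\<exists>k\<in>{..n}. P k x"
      by (intro bexI[of _ "LEAST n. P n x"]) (auto split: if_splits intro: LeastI)
  qed (auto intro: order_trans[OF Least_le])
  have [measurable]: "Measurable.pred (F n) (P k)" if "k \<in> {..n}" for k
    using measurable_from_subalg[OF sub P] that by simp
  show "Measurable.pred (F n) (\<lambda>x. (if \<exists>n. P n x then enat (LEAST n. P n x) else \<infinity>) \<le> enat n)"
    unfolding eq by measurable
qed

lemma fin_set_first_entry:
  "fin_set M (\<lambda>x. if \<exists>n. P n x then enat (LEAST n. P n x) else \<infinity>) = {x \<in> space M. \<exists>n. P n x}"
  by (auto simp: fin_set_def split: if_splits)

lemma fin_set_sets:
  assumes sub: "\<And>n. subalgebra M (F n)" and "ext_stopping_time F \<tau>"
  shows "fin_set M \<tau> \<in> sets M"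
proof -
  have [measurable]: "Measurable.pred M (\<lambda>x. \<tau> x \<le> enat n)" for n
    using assms(2) measurable_from_subalg[OF sub] by (auto simp: ext_stopping_time_def)
  have "\<tau> x < \<infinity> \<longleftrightarrow> (\<exists>n. \<tau> x \<le> enat n)" for x
    by (cases "\<tau> x") auto
  then have "fin_set M \<tau> = {x \<in> space M. \<exists>n. \<tau> x \<le> enat n}"
    by (simp add: fin_set_def)
  also have "\<dots> \<in> sets M" by measurable
  finally show ?thesis .
qed

section \<open>The maximal inequality of Doob with its sharp constant\<close>

text \<open>
  The running maximum starts at \<open>0\<close>, which makes it nonnegative everywhere although martingales
  of nonnegative functions are so only almost everywhere.
\<close>

primrec run_max :: "(nat \<Rightarrow> 'a \<Rightarrow> real) \<Rightarrow> nat \<Rightarrow> 'a \<Rightarrow> real" where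
  "run_max X 0 x = max 0 (X 0 x)"
| "run_max X (Suc n) x = max (run_max X n x) (X (Suc n) x)"

lemma run_max_nonneg: "0 \<le> run_max X n x"
  by (induction n) auto

lemma run_max_ge: "k \<le> n \<Longrightarrow> X k x \<le> run_max X n x"
  by (induction n) (auto simp: le_Suc_eq)

lemma run_max_le: "(\<And>k. k \<le> n \<Longrightarrow> X k x \<le> c) \<Longrightarrow> 0 \<le> c \<Longrightarrow> run_max X n x \<le> c"
  by (induction n) auto

lemma borel_measurable_run_max:
  assumes X: "\<And>k. k \<le> n \<Longrightarrow> X k \<in> borel_measurable M"
  shows "run_max X n \<in> borel_measurable M"
  using X
proof (induction n)
  case 0
  then have [measurable]: "X 0 \<in> borel_measurable M" by simp
  show ?case by simp
next
  case (Suc n)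
  then have [measurable]: "X (Suc n) \<in> borel_measurable M" "run_max X n \<in> borel_measurable M"
    by auto
  show ?case by simp
qed

text \<open>
  Young's inequality for the exponent \<open>q\<close> and its conjugate, applied to \<open>a powr (q - 1)\<close> and \<open>b\<close>.
\<close>

lemma Young_powr:
  fixes a b q :: real
  assumes "1 < q" "0 \<le> a" "0 \<le> b"
  shows "a powr (q - 1) * b \<le> (1 - 1 / q) * a powr q + 1 / q * b powr q"
proof -
  have "1 / (q / (q - 1)) + 1 / q = 1" using assms by (simp add: field_simps)
  moreover have "1 < q / (q - 1)" using assms by simp
  ultimately have "a powr (q - 1) * b
      \<le> (a powr (q - 1)) powr (q / (q - 1)) / (q / (q - 1)) + b powr q / q"
    using assms by (intro Youngs_inequality) auto
  also have "(a powr (q - 1)) powr (q / (q - 1)) = a powr q"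
    using assms by (simp add: powr_powr)
  also have "a powr q / (q / (q - 1)) = (1 - 1 / q) * a powr q"
    using assms by (simp add: field_simps)
  finally show ?thesis by simp
qed

text \<open>
  A discrete integration by parts for one step of the running maximum, which changes from \<open>S\<close> to
  \<open>max S X\<close> and is truncated at \<open>K\<close>.  If the truncated maximum grows at all, then its new value is
  at most \<open>X\<close>, and Young's inequality compares the increments of \<open>b powr q\<close> and \<open>b powr (q - 1)\<close>.
\<close>

lemma Doob_step:
  fixes K S X q :: real
  assumes q: "1 < q" and "0 \<le> K" "0 \<le> S"
  defines "a \<equiv> min K S" and "b \<equiv> min K (max S X)"
  shows "(1 - 1 / q) * b powr q + a powr (q - 1) * X
    \<le> (1 - 1 / q) * a powr q + b powr (q - 1) * X"
proof (cases "a = b")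
  case False
  then have ab: "0 \<le> a" "a \<le> b" and bX: "b \<le> X" using assms by (auto simp: min_def max_def split: if_splits)
  have "a powr (q - 1) * b \<le> (1 - 1 / q) * a powr q + 1 / q * b powr q"
    using q ab by (intro Young_powr) auto
  moreover have "b powr (q - 1) * b = b powr q"
    using powr_mult_base[of b "q - 1"] ab by (simp add: mult.commute)
  ultimately have "(1 - 1 / q) * b powr q \<le> (1 - 1 / q) * a powr q + (b powr (q - 1) - a powr (q - 1)) * b"
    by (simp add: algebra_simps)
  also have "(b powr (q - 1) - a powr (q - 1)) * b \<le> (b powr (q - 1) - a powr (q - 1)) * X"
    using bX ab q by (intro mult_left_mono) (auto intro!: powr_mono2)
  finally show ?thesis by (simp add: algebra_simps)
qed simp

text \<open>
  Let \<open>T n\<close> be the truncated running maximum.  The integrated steps telescope to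
  \<open>(1 - 1/q) \<integral> (T n)\<^sup>q \<le> \<integral> (T n)\<^bsup>q-1\<^esup> u\<close>, since \<open>u\<close> and its conditional expectation have the same integral
  against functions that are already measurable.  Young's inequality then bounds the right-hand
  side by \<open>\<integral> u\<^sup>q\<close> and a multiple of \<open>\<integral> (T n)\<^sup>q\<close> that can be absorbed; the truncation ensures that
  this integral is finite.
\<close>

lemma Doob_truncated:
  fixes u :: "'a \<Rightarrow> real" and q K :: real
  assumes N: "finite_measure N" and sub: "\<And>n. subalgebra N (F n)"
    and mono: "\<And>m n. m \<le> n \<Longrightarrow> sets (F m) \<subseteq> sets (F n)"
    and q: "1 < q" and K: "0 \<le> K"
    and u: "integrable N u" "\<And>x. 0 \<le> u x" and uq: "integrable N (\<lambda>x. u x powr q)"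
  defines "T \<equiv> \<lambda>n x. min K (run_max (\<lambda>n. real_cond_exp N (F n) u) n x)"
  shows "integrable N (\<lambda>x. T n x powr q)"
    and "(\<integral>x. T n x powr q \<partial>N) \<le> (q / (q - 1)) powr q * (\<integral>x. u x powr q \<partial>N)"
proof -
  interpret finite_measure N by fact
  have sfs: "sigma_finite_subalgebra N (F n)" for n
    by (rule sigma_finite_subalgebraI[OF N sub])
  define X where "X n = real_cond_exp N (F n) u" for n
  have T: "T n x = min K (run_max X n x)" for n x by (simp add: T_def X_def[abs_def])
  have XF: "X n \<in> borel_measurable (F n)" for n unfolding X_def by simp
  have subF: "subalgebra (F n) (F m)" if "m \<le> n" for m n
    using mono[OF that] sub[of n] sub[of m] by (auto simp: subalgebra_def)
  have TF: "T n \<in> borel_measurable (F m)" if "n \<le> m" for n m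
  proof -
    have [measurable]: "run_max X n \<in> borel_measurable (F m)"
      by (rule borel_measurable_run_max) (use XF subF that in \<open>meson le_trans measurable_from_subalg\<close>)
    show ?thesis unfolding T[abs_def] by measurable
  qed
  have TN [measurable]: "T n \<in> borel_measurable N" for n
    using TF[OF order_refl] sub measurable_from_subalg by blast
  have T0: "0 \<le> T n x" "T n x \<le> K" for n x using run_max_nonneg[of X n x] K by (auto simp: T)
  have bdd: "integrable N (\<lambda>x. T n x powr a * f x)" if "integrable N f" "0 \<le> a" for f n a
    by (rule Bochner_Integration.integrable_bound[OF integrable_mult_right[OF that(1), of "K powr a"]])
      (use that T0 K in \<open>auto simp: abs_mult intro!: mult_right_mono powr_mono2\<close>)
  have int: "integrable N (\<lambda>x. T n x powr q)" for n
    using bdd[of "\<lambda>_. 1" q n] q by simp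
  then show "integrable N (\<lambda>x. T n x powr q)" .
  have Xint: "integrable N (X n)" for n
    unfolding X_def using sigma_finite_subalgebra.real_cond_exp_int(1)[OF sfs u(1)] .
  \<comment> \<open>The exponent \<open>q - 1\<close> stays on a function known at time \<open>m\<close>, so the martingale may be replaced by \<open>u\<close>.\<close>
  have TX: "(\<integral>x. T n x powr (q - 1) * X m x \<partial>N) = (\<integral>x. T n x powr (q - 1) * u x \<partial>N)"
    if "n \<le> m" for n m
  proof -
    have [measurable]: "T n \<in> borel_measurable (F m)" by (rule TF[OF that])
    show ?thesis unfolding X_def
      by (rule sigma_finite_subalgebra.real_cond_exp_intg(2)[OF sfs])
        (use q in \<open>auto intro!: bdd u(1) borel_measurable_integrable\<close>)
  qed
  have key: "(1 - 1 / q) * (\<integral>x. T n x powr q \<partial>N) \<le> (\<integral>x. T n x powr (q - 1) * u x \<partial>N)" for n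
  proof (induction n)
    case 0
    have "(1 - 1 / q) * T 0 x powr q \<le> T 0 x powr (q - 1) * X 0 x" for x
    proof (cases "X 0 x \<le> 0")
      case True
      then show ?thesis using K by (simp add: T max_def min_def)
    next
      case False
      have "(1 - 1 / q) * T 0 x powr q \<le> T 0 x powr q"
        using q by (simp add: mult_left_le_one_le)
      also have "\<dots> = T 0 x powr (q - 1) * T 0 x"
        using powr_mult_base[of "T 0 x" "q - 1"] T0 by (simp add: mult.commute)
      also have "\<dots> \<le> T 0 x powr (q - 1) * X 0 x"
        using False by (intro mult_left_mono) (auto simp: T)
      finally show ?thesis .
    qed
    then have "(\<integral>x. (1 - 1 / q) * T 0 x powr q \<partial>N) \<le> (\<integral>x. T 0 x powr (q - 1) * X 0 x \<partial>N)"
      using q by (intro integral_mono integrable_mult_right int bdd Xint) auto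
    then show ?case by (simp add: TX)
  next
    case (Suc n)
    have "(\<integral>x. (1 - 1 / q) * T (Suc n) x powr q + T n x powr (q - 1) * X (Suc n) x \<partial>N)
        \<le> (\<integral>x. (1 - 1 / q) * T n x powr q + T (Suc n) x powr (q - 1) * X (Suc n) x \<partial>N)"
      using q Doob_step[OF q K run_max_nonneg]
      by (intro integral_mono Bochner_Integration.integrable_add integrable_mult_right int bdd Xint)
        (auto simp: T)
    then have "(1 - 1 / q) * (\<integral>x. T (Suc n) x powr q \<partial>N) + (\<integral>x. T n x powr (q - 1) * u x \<partial>N)
        \<le> (1 - 1 / q) * (\<integral>x. T n x powr q \<partial>N) + (\<integral>x. T (Suc n) x powr (q - 1) * u x \<partial>N)"
      using q by (simp add: Bochner_Integration.integral_add int bdd Xint TX)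
    with Suc.IH show ?case by linarith
  qed
  define q' where "q' = q / (q - 1)"
  have q': "0 < q'" "(1 - 1 / q) * q' = 1" using q by (auto simp: q'_def field_simps)
  have "q' * (\<integral>x. T n x powr (q - 1) * u x \<partial>N)
      \<le> (\<integral>x. (1 - 1 / q) * T n x powr q + q' powr q / q * u x powr q \<partial>N)"
    unfolding integral_mult_right_zero[symmetric]
  proof (intro integral_mono integrable_mult_right Bochner_Integration.integrable_add int bdd u uq)
    fix x
    show "q' * (T n x powr (q - 1) * u x) \<le> (1 - 1 / q) * T n x powr q + q' powr q / q * u x powr q"
      using Young_powr[OF q T0(1)[of n x], of "q' * u x"] u(2)[of x] q' q by (simp add: powr_mult mult_ac)
  qed (use q in auto)
  also have "\<dots> = (1 - 1 / q) * (\<integral>x. T n x powr q \<partial>N) + q' powr q / q * (\<integral>x. u x powr q \<partial>N)"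
    by (simp add: Bochner_Integration.integral_add int uq)
  finally have "q' * (\<integral>x. T n x powr (q - 1) * u x \<partial>N)
    \<le> (1 - 1 / q) * (\<integral>x. T n x powr q \<partial>N) + q' powr q / q * (\<integral>x. u x powr q \<partial>N)" .
  moreover have "(\<integral>x. T n x powr q \<partial>N) \<le> q' * (\<integral>x. T n x powr (q - 1) * u x \<partial>N)"
  proof -
    have "(\<integral>x. T n x powr q \<partial>N) = ((1 - 1 / q) * q') * (\<integral>x. T n x powr q \<partial>N)"
      by (simp only: q'(2) mult_1)
    also have "\<dots> = q' * ((1 - 1 / q) * (\<integral>x. T n x powr q \<partial>N))" by (simp only: mult_ac)
    also have "\<dots> \<le> q' * (\<integral>x. T n x powr (q - 1) * u x \<partial>N)"
      using q'(1) by (intro mult_left_mono key) simp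
    finally show ?thesis .
  qed
  ultimately have "1 / q * (\<integral>x. T n x powr q \<partial>N) \<le> 1 / q * (q' powr q * (\<integral>x. u x powr q \<partial>N))"
    by (simp add: algebra_simps)
  then show "(\<integral>x. T n x powr q \<partial>N) \<le> (q / (q - 1)) powr q * (\<integral>x. u x powr q \<partial>N)"
    using q by (simp add: q'_def divide_le_cancel)
qed

text \<open>
  Removing the truncation level by the lemma of Fatou.
\<close>

lemma Doob_maximal_Lq:
  fixes u :: "'a \<Rightarrow> real" and q :: real
  assumes N: "finite_measure N" and sub: "\<And>n. subalgebra N (F n)"
    and mono: "\<And>m n. m \<le> n \<Longrightarrow> sets (F m) \<subseteq> sets (F n)"
    and q: "1 < q"
    and u: "integrable N u" "\<And>x. 0 \<le> u x" and uq: "integrable N (\<lambda>x. u x powr q)"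
  shows "(\<integral>\<^sup>+x. ennreal (run_max (\<lambda>n. real_cond_exp N (F n) u) n x powr q) \<partial>N)
    \<le> ennreal ((q / (q - 1)) powr q * (\<integral>x. u x powr q \<partial>N))"
proof (rule nn_integral_le_of_tendsto[OF _ _ _ tendsto_const])
  let ?S = "run_max (\<lambda>n. real_cond_exp N (F n) u) n"
  let ?f = "\<lambda>K::nat. \<lambda>x. ennreal (min (real K) (?S x) powr q)"
  have [measurable]: "?S \<in> borel_measurable N" by (rule borel_measurable_run_max) simp
  show "?f K \<in> borel_measurable N" for K by measurable
  show "AE x in N. (\<lambda>K. ?f K x) \<longlonglongrightarrow> ennreal (?S x powr q)"
  proof (rule AE_I2, rule tendsto_eventually)
    fix x
    obtain K0 where "?S x \<le> real K0" using real_arch_simple by blast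
    then show "\<forall>\<^sub>F K in sequentially. ?f K x = ennreal (?S x powr q)"
      unfolding eventually_sequentially by (intro exI[of _ K0]) (auto simp: min_absorb2)
  qed
  show "(\<integral>\<^sup>+x. ?f K x \<partial>N) \<le> ennreal ((q / (q - 1)) powr q * (\<integral>x. u x powr q \<partial>N))" for K
    using Doob_truncated[OF N sub mono q _ u uq, where K = "real K" and n = n]
    by (subst nn_integral_eq_integral) (auto intro: ennreal_leI)
qed

section \<open>The family of dual weights\<close>

text \<open>
  The standing assumptions, expressed through the dual weights \<open>s i\<close> alone.  The functions \<open>s i\<close>
  are nonnegative everywhere because powers of real numbers are.
\<close>

locale sigma_family = prob_space M for M :: "'a measure" +
  fixes F :: "nat \<Rightarrow> 'a measure" and p :: real and ps :: "nat \<Rightarrow> real"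
    and s :: "nat \<Rightarrow> 'a \<Rightarrow> real"
  assumes subalg: "\<And>n. subalgebra M (F n)"
    and sets_mono: "\<And>m n. m \<le> n \<Longrightarrow> sets (F m) \<subseteq> sets (F n)"
    and ps: "\<And>i. 1 < ps i" and p: "0 < p" and ps_sums: "(\<lambda>i. 1 / ps i) sums (1 / p)"
    and s_int: "\<And>i. integrable M (s i)" and s_nonneg: "\<And>i x. 0 \<le> s i x"
    and s_pos: "\<And>i. AE x in M. 0 < s i x"
    and mass_conv: "convergent (\<lambda>n. \<Prod>i<n. (\<integral>x. s i x \<partial>M) powr (1 / ps i))"
    and cond_conv: "\<And>n. AE x in M. convergent
          (\<lambda>k. \<Prod>i<k. real_cond_exp M (F n) (s i) x powr (1 / conj_exp (ps i)))"
    and dens_conv: "AE x in M. convergent (\<lambda>n. \<Prod>i<n. s i x powr (1 / ps i))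
          \<and> 0 < iprod (\<lambda>i. s i x powr (1 / ps i))"
begin

definition mass :: "nat \<Rightarrow> real" where "mass i = (\<integral>x. s i x \<partial>M)"

text \<open>
  The product of the norms of the constant function \<open>1\<close> in \<open>L\<^bsup>p\<^sub>i\<^esup>(s\<^sub>i)\<close>.
\<close>

definition mass_prod :: real where "mass_prod = iprod (\<lambda>i. mass i powr (1 / ps i))"

text \<open>
  The density on the right-hand side of the reverse Hoelder condition.
\<close>

definition dens :: "'a \<Rightarrow> real" where "dens x = iprod (\<lambda>i. s i x powr (p / ps i))"

definition cond_s :: "nat \<Rightarrow> nat \<Rightarrow> 'a \<Rightarrow> real" where "cond_s n i = real_cond_exp M (F n) (s i)"

lemma s_meas [measurable]: "s i \<in> borel_measurable M"
  using s_int by auto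

lemma dens_meas [measurable]: "dens \<in> borel_measurable M"
  unfolding dens_def[abs_def] iprod_def by measurable

lemma ps_pos: "0 < ps i" using ps[of i] by linarith

lemma sfs: "sigma_finite_subalgebra M (F n)"
  by (rule sigma_finite_subalgebraI[OF _ subalg]) (rule finite_measure_axioms)

lemma subF: "m \<le> n \<Longrightarrow> subalgebra (F n) (F m)"
  using sets_mono[of m n] subalg[of n] subalg[of m] by (auto simp: subalgebra_def)

lemma mass_pos: "0 < mass i"
proof -
  have "mass i \<noteq> 0"
  proof
    assume "mass i = 0"
    then have "AE x in M. s i x = 0"
      using integral_nonneg_eq_0_iff_AE[OF s_int[of i]] s_nonneg by (simp add: mass_def)
    with s_pos[of i] have "AE x in M. False" by eventually_elim simp
    then show False by simp
  qed
  moreover have "0 \<le> mass i" unfolding mass_def by (simp add: s_nonneg)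
  ultimately show ?thesis by simp
qed

lemma sum_exps_le: "(\<Sum>i<N. p / ps i) \<le> 1"
proof -
  have "(\<lambda>i. p * (1 / ps i)) sums (p * (1 / p))" by (rule sums_mult[OF ps_sums])
  then have "(\<lambda>i. p / ps i) sums 1" using p by simp
  then show ?thesis
    using sum_le_suminf[of "\<lambda>i. p / ps i" "{..<N}"] ps_pos p
    by (simp add: sums_iff less_imp_le)
qed

lemma mass_lim: "(\<lambda>N. \<Prod>i<N. mass i powr (1 / ps i)) \<longlonglongrightarrow> mass_prod"
  unfolding mass_prod_def using mass_conv by (intro iprod_lim) (simp add: mass_def)

lemma mass_lim_p: "(\<lambda>N. \<Prod>i<N. mass i powr (p / ps i)) \<longlonglongrightarrow> mass_prod powr p"
  using iprod_powr[OF _ mass_lim p] by (simp add: powr_powr)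

lemma dens_lim:
  "AE x in M. (\<lambda>N. \<Prod>i<N. s i x powr (p / ps i)) \<longlonglongrightarrow> dens x \<and> 0 < dens x"
  using dens_conv
proof eventually_elim
  case (elim x)
  let ?L = "iprod (\<lambda>i. s i x powr (1 / ps i))"
  have "(\<lambda>n. \<Prod>i<n. s i x powr (1 / ps i)) \<longlonglongrightarrow> ?L" using elim by (simp add: iprod_lim)
  from iprod_powr[OF _ this p] have *: "(\<lambda>n. \<Prod>i<n. s i x powr (p / ps i)) \<longlonglongrightarrow> ?L powr p"
    by (simp add: powr_powr)
  then have "dens x = ?L powr p" unfolding dens_def by (rule iprod_eqI)
  with * elim show ?case by simp
qed

text \<open>
  If the product of the norms vanished, Hoelder's inequality and the lemma of Fatou would force
  \<open>dens\<close> to vanish almost everywhere.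
\<close>

lemma mass_prod_pos: "0 < mass_prod"
proof -
  have "0 \<le> mass_prod" by (rule LIMSEQ_le_const[OF mass_lim]) (auto intro!: prod_nonneg)
  moreover have "mass_prod \<noteq> 0"
  proof
    assume "mass_prod = 0"
    have "(\<integral>\<^sup>+x. ennreal (dens x) \<partial>M) \<le> ennreal (mass_prod powr p)"
    proof (rule nn_integral_le_of_tendsto)
      show "AE x in M. (\<lambda>N. ennreal (\<Prod>i<N. s i x powr (p / ps i))) \<longlonglongrightarrow> ennreal (dens x)"
        using dens_lim by eventually_elim auto
      show "(\<lambda>N. ennreal (\<Prod>i<N. mass i powr (p / ps i))) \<longlonglongrightarrow> ennreal (mass_prod powr p)"
        by (rule tendsto_ennrealI[OF mass_lim_p])
      show "(\<integral>\<^sup>+x. ennreal (\<Prod>i<N. s i x powr (p / ps i)) \<partial>M)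
          \<le> ennreal (\<Prod>i<N. mass i powr (p / ps i))" for N
        using p ps_pos
        by (intro Holder_prod_le sum_exps_le mass_pos s_nonneg)
          (auto simp: mass_def nn_integral_eq_integral s_int s_nonneg less_imp_le)
    qed measurable
    then have "(\<integral>\<^sup>+x. ennreal (dens x) \<partial>M) = 0" using p \<open>mass_prod = 0\<close> by simp
    then have "AE x in M. ennreal (dens x) = 0" by (subst (asm) nn_integral_0_iff_AE) auto
    with dens_lim have "AE x in M. False" by eventually_elim auto
    then show False by simp
  qed
  ultimately show ?thesis by simp
qed

lemma cond_s_meas [measurable]: "cond_s n i \<in> borel_measurable M" by (simp add: cond_s_def)

lemma cond_s_nonneg: "AE x in M. \<forall>n i. 0 \<le> cond_s n i x"
  unfolding cond_s_def AE_all_countable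
  by (intro allI sigma_finite_subalgebra.real_cond_exp_pos[OF sfs]) (auto simp: s_nonneg)

text \<open>
  The assumption gives convergence only after raising the factors to the powers \<open>1 - 1/p\<^sub>i\<close>.  For
  the complementary powers \<open>1/p\<^sub>i\<close>, divide the factors by their means: then
  \<open>\<Sum>\<^sub>i (1/p\<^sub>i) E\<^sub>n(s\<^sub>i) / mass\<^sub>i\<close> has the integral \<open>\<Sum>\<^sub>i 1/p\<^sub>i < \<infinity>\<close> and is finite almost everywhere, so
  that the product of the quotients converges.
\<close>

lemma cond_s_prod_convergent: "AE x in M. \<forall>n. convergent (\<lambda>N. \<Prod>i<N. cond_s n i x)"
  unfolding AE_all_countable
proof
  fix n
  have "AE x in M. (\<Sum>i. ennreal (1 / ps i * max 0 (cond_s n i x / mass i))) \<noteq> \<infinity>"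
  proof (rule nn_integral_PInf_AE)
    have "(\<integral>\<^sup>+x. ennreal (1 / ps i * max 0 (cond_s n i x / mass i)) \<partial>M) = ennreal (1 / ps i)" for i
    proof -
      have i: "integrable M (cond_s n i)" "(\<integral>x. cond_s n i x \<partial>M) = mass i"
        using sigma_finite_subalgebra.real_cond_exp_int[OF sfs s_int] by (auto simp: cond_s_def mass_def)
      have "(\<integral>\<^sup>+x. ennreal (1 / ps i * max 0 (cond_s n i x / mass i)) \<partial>M)
          = (\<integral>\<^sup>+x. ennreal (1 / ps i / mass i * cond_s n i x) \<partial>M)"
        by (intro nn_integral_cong_AE, use cond_s_nonneg in eventually_elim)
          (use mass_pos[of i] in \<open>simp add: max_absorb2\<close>)
      also have "\<dots> = ennreal (1 / ps i / mass i * mass i)"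
        using i mass_pos[of i] ps_pos[of i] cond_s_nonneg
        by (subst nn_integral_eq_integral) (auto simp: elim!: eventually_mono)
      finally show ?thesis using mass_pos[of i] by simp
    qed
    then have "(\<integral>\<^sup>+x. (\<Sum>i. ennreal (1 / ps i * max 0 (cond_s n i x / mass i))) \<partial>M)
        = (\<Sum>i. ennreal (1 / ps i))"
      by (subst nn_integral_suminf) auto
    also have "\<dots> = ennreal (1 / p)"
      using ps_sums ps_pos by (intro suminf_ennreal_eq) (auto simp: less_imp_le)
    finally show "(\<integral>\<^sup>+x. (\<Sum>i. ennreal (1 / ps i * max 0 (cond_s n i x / mass i))) \<partial>M) \<noteq> \<infinity>"
      by simp
  qed measurable
  then show "AE x in M. convergent (\<lambda>N. \<Prod>i<N. cond_s n i x)"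
    using cond_conv[of n] cond_s_nonneg
  proof eventually_elim
    case (elim x)
    let ?y = "\<lambda>i. cond_s n i x / mass i"
    have y0: "0 \<le> ?y i" for i using elim mass_pos[of i] by simp
    have "summable (\<lambda>i. 1 / ps i * ?y i)"
    proof (rule summable_suminf_not_top)
      show "0 \<le> 1 / ps i * ?y i" for i
        by (rule mult_nonneg_nonneg[OF _ y0]) (simp add: ps_pos less_imp_le)
      show "(\<Sum>i. ennreal (1 / ps i * ?y i)) \<noteq> \<top>"
        using elim(1) y0 by (simp add: max_absorb2)
    qed
    then have "convergent (\<lambda>N. \<Prod>i<N. ?y i powr (1 / ps i))"
      using y0 ps_pos by (intro convergent_prod_powr_of_summable) (auto simp: less_imp_le)
    then obtain L1 where L1: "(\<lambda>N. \<Prod>i<N. ?y i powr (1 / ps i)) \<longlonglongrightarrow> L1"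
      by (auto simp: convergent_def)
    obtain L2 where L2: "(\<lambda>N. \<Prod>i<N. cond_s n i x powr (1 / conj_exp (ps i))) \<longlonglongrightarrow> L2"
      using elim(2) by (auto simp: convergent_def cond_s_def)
    \<comment> \<open>Both sides vanish if \<open>cond_s n i x\<close> does, since \<open>0 powr a = 0\<close>.\<close>
    have split: "cond_s n i x = mass i powr (1 / ps i) * ?y i powr (1 / ps i) * cond_s n i x powr (1 / conj_exp (ps i))" for i
    proof (cases "cond_s n i x = 0")
      case False
      moreover have "0 \<le> cond_s n i x" using elim(3) by simp
      ultimately have pos: "0 < cond_s n i x" by simp
      have "1 / ps i + 1 / conj_exp (ps i) = 1"
        using ps[of i] by (simp add: conj_exp_def field_simps)
      then have "cond_s n i x = cond_s n i x powr (1 / ps i) * cond_s n i x powr (1 / conj_exp (ps i))"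
        using pos by (metis powr_add powr_one less_imp_le)
      then show ?thesis using mass_pos[of i] pos by (simp add: powr_divide)
    qed simp
    have "(\<lambda>N. \<Prod>i<N. cond_s n i x) \<longlonglongrightarrow> mass_prod * L1 * L2"
      using tendsto_mult[OF tendsto_mult[OF mass_lim L1] L2]
      by (subst split) (simp add: prod.distrib)
    then show ?case by (rule convergentI)
  qed
qed

end

section \<open>The martingales of one family of functions\<close>

text \<open>
  Normalised functions: at least \<open>1\<close>, with \<open>L\<^bsup>p\<^sub>i\<^esup>(s\<^sub>i)\<close>-norm comparable to that of the constant \<open>1\<close>.
\<close>

locale doob_estimate = sigma_family M F p ps s
  for M :: "'a measure" and F p ps s +
  fixes u :: "nat \<Rightarrow> 'a \<Rightarrow> real"
  assumes u_meas [measurable]: "\<And>i. u i \<in> borel_measurable M"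
    and u_ge: "\<And>i x. 1 \<le> u i x"
    and u_int: "\<And>i. integrable M (\<lambda>x. u i x powr ps i * s i x)"
    and u_le: "\<And>i. (\<integral>x. u i x powr ps i * s i x \<partial>M) \<le> 2 * mass i"
begin

definition weighted_measure :: "nat \<Rightarrow> 'a measure" where
  "weighted_measure i = density M (\<lambda>x. ennreal (s i x))"

definition weighted_exp :: "nat \<Rightarrow> nat \<Rightarrow> 'a \<Rightarrow> real" where
  "weighted_exp i n = real_cond_exp (weighted_measure i) (F n) (u i)"

text \<open>
  The supremum is almost everywhere the limit of the partial products, since the
  factors are then at least \<open>1\<close>.  Defined as a supremum it is measurable with respect to \<open>F n\<close>
  and makes sense everywhere, as is needed for stopping times.
\<close>

definition prod_powr :: "nat \<Rightarrow> 'a \<Rightarrow> ennreal" where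
  "prod_powr n x = (SUP k. ennreal (\<Prod>i<k. weighted_exp i n x powr p))"

lemma weighted_measure_sets [measurable_cong]: "sets (weighted_measure i) = sets M"
  by (simp add: weighted_measure_def)

lemma weighted_measure_finite: "finite_measure (weighted_measure i)"
  using s_int[of i] s_nonneg
  by (intro finite_measureI) (simp add: weighted_measure_def emeasure_density nn_integral_eq_integral)

lemma weighted_measure_sub: "subalgebra (weighted_measure i) (F n)"
  using subalg[of n] by (simp add: subalgebra_def weighted_measure_def)

lemma weighted_measure_sfs: "sigma_finite_subalgebra (weighted_measure i) (F n)"
  by (rule sigma_finite_subalgebraI[OF weighted_measure_finite weighted_measure_sub])

lemma weighted_exp_measF: "weighted_exp i n \<in> borel_measurable (F n)" by (simp add: weighted_exp_def)

lemma weighted_exp_meas [measurable]: "weighted_exp i n \<in> borel_measurable M"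
  using measurable_from_subalg[OF subalg weighted_exp_measF] .

lemma prod_powr_measF: "prod_powr n \<in> borel_measurable (F n)"
proof -
  note weighted_exp_measF[measurable]
  show ?thesis unfolding prod_powr_def[abs_def] by measurable
qed

lemma prod_powr_meas [measurable]: "prod_powr n \<in> borel_measurable M"
  using measurable_from_subalg[OF subalg prod_powr_measF] .

lemma us_int: "integrable M (\<lambda>x. u i x * s i x)"
proof (rule Bochner_Integration.integrable_bound[OF u_int[of i]])
  show "AE x in M. norm (u i x * s i x) \<le> norm (u i x powr ps i * s i x)"
  proof (rule AE_I2)
    fix x
    have "u i x powr 1 \<le> u i x powr ps i"
      using u_ge[of i x] ps[of i] by (intro powr_mono) auto
    then show "norm (u i x * s i x) \<le> norm (u i x powr ps i * s i x)"
      using u_ge[of i x] s_nonneg[of i x] by (simp add: abs_mult mult_right_mono)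
  qed
qed measurable

lemma u_intN: "integrable (weighted_measure i) (u i)" "integrable (weighted_measure i) (\<lambda>x. u i x powr ps i)"
  using us_int[of i] u_int[of i] s_nonneg unfolding weighted_measure_def
  by (auto simp: integrable_density mult.commute)

lemma weighted_exp_ge: "AE x in M. \<forall>i n. 1 \<le> weighted_exp i n x"
  unfolding AE_all_countable
proof (intro allI)
  fix i n
  have "AE x in weighted_measure i. 1 \<le> weighted_exp i n x"
    unfolding weighted_exp_def
    by (rule sigma_finite_subalgebra.real_cond_exp_ge_c[OF weighted_measure_sfs u_intN(1)]) (simp add: u_ge)
  then have "AE x in M. 0 < s i x \<longrightarrow> 1 \<le> weighted_exp i n x"
    unfolding weighted_measure_def by (subst (asm) AE_density) auto
  with s_pos[of i] show "AE x in M. 1 \<le> weighted_exp i n x" by eventually_elim simp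
qed

lemma cond_exp_us:
  "AE x in M. \<forall>i n. real_cond_exp M (F n) (\<lambda>x. u i x * s i x) x = weighted_exp i n x * cond_s n i x"
  unfolding AE_all_countable weighted_exp_def cond_s_def weighted_measure_def
  by (intro allI real_cond_exp_density subalg s_int s_nonneg us_int u_meas finite_measure_axioms)

lemma incseq_prod_weighted_exp:
  assumes "\<And>i n. 1 \<le> weighted_exp i n x"
  shows "incseq (\<lambda>k. \<Prod>i<k. weighted_exp i n x powr p)"
proof (rule incseq_SucI)
  fix k
  have "1 \<le> weighted_exp k n x powr p" using assms p by (simp add: ge_one_powr_ge_zero)
  from mult_left_mono[OF this, of "\<Prod>i<k. weighted_exp i n x powr p"]
  show "(\<Prod>i<k. weighted_exp i n x powr p) \<le> (\<Prod>i<Suc k. weighted_exp i n x powr p)"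
    by (simp add: prod_nonneg)
qed

text \<open>
  Finitely many factors and finitely many times: a real-valued function that increases to the
  supremum of all \<open>prod_powr n\<close>.
\<close>

definition run_prod :: "nat \<Rightarrow> 'a \<Rightarrow> real" where
  "run_prod K = run_max (\<lambda>k x. \<Prod>i<K. weighted_exp i k x powr p) K"

lemma run_prod_meas [measurable]: "run_prod K \<in> borel_measurable M"
  unfolding run_prod_def by (rule borel_measurable_run_max) measurable

lemma run_prod_nonneg: "0 \<le> run_prod K x"
  unfolding run_prod_def by (rule run_max_nonneg)

lemma run_prod_mono:
  assumes X1: "\<And>i n. 1 \<le> weighted_exp i n x" and "K \<le> L"
  shows "run_prod K x \<le> run_prod L x"
  unfolding run_prod_def
proof (rule run_max_le)
  fix k assume "k \<le> K"
  have "(\<Prod>i<K. weighted_exp i k x powr p) \<le> (\<Prod>i<L. weighted_exp i k x powr p)"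
    using incseqD[OF incseq_prod_weighted_exp[OF X1] \<open>K \<le> L\<close>] .
  also have "\<dots> \<le> run_max (\<lambda>k x. \<Prod>i<L. weighted_exp i k x powr p) L x"
    using \<open>k \<le> K\<close> \<open>K \<le> L\<close> by (intro run_max_ge) simp
  finally show "(\<Prod>i<K. weighted_exp i k x powr p) \<le> run_max (\<lambda>k x. \<Prod>i<L. weighted_exp i k x powr p) L x" .
qed (rule run_max_nonneg)

lemma run_prod_le:
  assumes X1: "\<And>i n. 1 \<le> weighted_exp i n x" and "K \<le> L"
  shows "run_prod K x \<le> (\<Prod>i<L. run_max (weighted_exp i) L x powr p)"
proof -
  have "run_prod L x \<le> (\<Prod>i<L. run_max (weighted_exp i) L x powr p)"
    unfolding run_prod_def
  proof (rule run_max_le)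
    fix k assume "k \<le> L"
    then show "(\<Prod>i<L. weighted_exp i k x powr p) \<le> (\<Prod>i<L. run_max (weighted_exp i) L x powr p)"
      using p by (intro prod_mono conjI powr_mono2 run_max_ge)
        (auto intro: order_trans[OF zero_le_one X1])
  qed (simp add: prod_nonneg)
  with run_prod_mono[OF X1 \<open>K \<le> L\<close>] show ?thesis by linarith
qed

lemma prod_powr_le_run_prod: "(SUP n. prod_powr n x) \<le> (SUP K. ennreal (run_prod K x))"
  if X1: "\<And>i n. 1 \<le> weighted_exp i n x"
proof (rule SUP_least)
  fix n
  show "prod_powr n x \<le> (SUP K. ennreal (run_prod K x))"
    unfolding prod_powr_def
  proof (rule SUP_least)
    fix k
    let ?K = "max n k"
    have "(\<Prod>i<k. weighted_exp i n x powr p) \<le> (\<Prod>i<?K. weighted_exp i n x powr p)"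
      using incseqD[OF incseq_prod_weighted_exp[OF X1], of k ?K] by simp
    also have "\<dots> \<le> run_prod ?K x" unfolding run_prod_def by (rule run_max_ge) simp
    finally show "ennreal (\<Prod>i<k. weighted_exp i n x powr p) \<le> (SUP K. ennreal (run_prod K x))"
      by (intro SUP_upper2[of ?K] ennreal_leI) auto
  qed
qed

text \<open>
  For \<open>L\<close> factors and times up to \<open>L\<close>, the maximum of the products is at most the product of the
  running maxima.  Hoelder's inequality with the exponents \<open>p / p\<^sub>i\<close> separates the factors, and Doob's
  inequality in each measure \<open>s\<^sub>i d\<mu>\<close> contributes \<open>p\<^sub>i / (p\<^sub>i - 1)\<close>.  The limits are taken in two
  rounds: first in the product of the weights with \<open>run_prod K\<close> fixed and finite, then in \<open>K\<close>.
  In this way no product \<open>0 \<cdot> \<infinity>\<close> occurs.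
\<close>

lemma sup_prod_powr_bound:
  assumes B: "0 < B" "\<And>N. (\<Prod>i<N. ps i / (ps i - 1)) \<le> B"
  shows "(\<integral>\<^sup>+x. (SUP n. prod_powr n x) * ennreal (dens x) \<partial>M) \<le> ennreal (2 * B powr p * mass_prod powr p)"
proof -
  define c where "c L = 2 * B powr p * (\<Prod>i<L. mass i powr (p / ps i))" for L
  have c: "(\<lambda>L. ennreal (c L)) \<longlonglongrightarrow> ennreal (2 * B powr p * mass_prod powr p)"
    unfolding c_def by (intro tendsto_ennrealI tendsto_mult_left mass_lim_p)
  have rm [measurable]: "run_max (weighted_exp i) L \<in> borel_measurable M" for i L
    by (rule borel_measurable_run_max) simp
  have holder: "(\<integral>\<^sup>+x. ennreal (\<Prod>i<L. run_max (weighted_exp i) L x powr p * s i x powr (p / ps i)) \<partial>M) \<le> ennreal (c L)" for L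
  proof -
    define d where "d i = (ps i / (ps i - 1)) powr ps i * (2 * mass i)" for i
    have "(\<integral>\<^sup>+x. ennreal (\<Prod>i<L. (run_max (weighted_exp i) L x powr ps i * s i x) powr (p / ps i)) \<partial>M)
        \<le> ennreal (\<Prod>i<L. d i powr (p / ps i))"
    proof (rule Holder_prod_le[OF _ _ _ _ sum_exps_le])
      show "(\<integral>\<^sup>+x. ennreal (run_max (weighted_exp i) L x powr ps i * s i x) \<partial>M) \<le> ennreal (d i)" for i
      proof -
        have "(\<integral>\<^sup>+x. ennreal (run_max (weighted_exp i) L x powr ps i * s i x) \<partial>M)
            = (\<integral>\<^sup>+x. ennreal (run_max (weighted_exp i) L x powr ps i) \<partial>weighted_measure i)"
          unfolding weighted_measure_def using s_nonneg
          by (subst nn_integral_density) (auto simp: ennreal_mult mult.commute)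
        also have "\<dots> \<le> ennreal ((ps i / (ps i - 1)) powr ps i * (\<integral>x. u i x powr ps i \<partial>weighted_measure i))"
          unfolding weighted_exp_def
          by (rule Doob_maximal_Lq[OF weighted_measure_finite weighted_measure_sub sets_mono ps u_intN(1) _ u_intN(2)])
            (auto intro: order_trans[OF zero_le_one u_ge])
        also have "(\<integral>x. u i x powr ps i \<partial>weighted_measure i) = (\<integral>x. u i x powr ps i * s i x \<partial>M)"
          unfolding weighted_measure_def using s_nonneg by (subst integral_density) (auto simp: mult.commute)
        also have "ennreal ((ps i / (ps i - 1)) powr ps i * (\<integral>x. u i x powr ps i * s i x \<partial>M)) \<le> ennreal (d i)"
          unfolding d_def by (intro ennreal_leI mult_left_mono u_le) simp
        finally show ?thesis .
      qed
      show "0 < d i" for i using ps[of i] mass_pos[of i] by (auto simp: d_def)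
    qed (use s_nonneg p ps_pos in \<open>auto simp: less_imp_le\<close>)
    also have "(\<Prod>i<L. d i powr (p / ps i))
        = (\<Prod>i<L. ps i / (ps i - 1)) powr p * 2 powr (\<Sum>i<L. p / ps i) * (\<Prod>i<L. mass i powr (p / ps i))"
    proof -
      have "d i powr (p / ps i) = (ps i / (ps i - 1)) powr p * 2 powr (p / ps i) * mass i powr (p / ps i)" for i
        using ps[of i] ps_pos[of i] mass_pos[of i]
        by (simp add: d_def powr_mult powr_powr)
      then show ?thesis
        using ps by (simp add: prod.distrib prod_powr_distrib powr_sum less_imp_le)
    qed
    also have "ennreal \<dots> \<le> ennreal (c L)"
    proof -
      have "(\<Prod>i<L. ps i / (ps i - 1)) powr p \<le> B powr p"
        using B(2) p ps ps_pos by (intro powr_mono2 prod_nonneg) (auto intro!: divide_nonneg_nonneg simp: less_imp_le)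
      moreover have "2 powr (\<Sum>i<L. p / ps i) \<le> (2::real)"
        using powr_mono[OF sum_exps_le[of L], of "2::real"] by simp
      ultimately have "(\<Prod>i<L. ps i / (ps i - 1)) powr p * 2 powr (\<Sum>i<L. p / ps i) \<le> B powr p * 2"
        by (intro mult_mono) auto
      then show ?thesis
        unfolding c_def by (intro ennreal_leI mult_right_mono) (auto simp: mult.commute prod_nonneg)
    qed
    finally show ?thesis
      using ps_pos s_nonneg by (simp add: powr_mult powr_powr less_imp_neq[symmetric])
  qed
  have run_prod_int: "(\<integral>\<^sup>+x. ennreal (run_prod K x) * ennreal (dens x) \<partial>M) \<le> ennreal (2 * B powr p * mass_prod powr p)" for K
  proof (rule nn_integral_le_of_tendsto[OF _ _ _ LIMSEQ_ignore_initial_segment[OF c, of K]])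
    let ?f = "\<lambda>L x. ennreal (run_prod K x * (\<Prod>i<L + K. s i x powr (p / ps i)))"
    show "?f L \<in> borel_measurable M" for L by measurable
    show "AE x in M. (\<lambda>L. ?f L x) \<longlonglongrightarrow> ennreal (run_prod K x) * ennreal (dens x)"
      using dens_lim
    proof eventually_elim
      case (elim x)
      then have "(\<lambda>L. \<Prod>i<L + K. s i x powr (p / ps i)) \<longlonglongrightarrow> dens x"
        using LIMSEQ_ignore_initial_segment by blast
      then have "(\<lambda>L. ?f L x) \<longlonglongrightarrow> ennreal (run_prod K x * dens x)"
        by (intro tendsto_ennrealI tendsto_mult_left)
      then show ?case using elim run_prod_nonneg by (simp add: ennreal_mult)
    qed
    show "(\<integral>\<^sup>+x. ?f L x \<partial>M) \<le> ennreal (c (L + K))" for L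
    proof (rule order_trans[OF _ holder])
      show "(\<integral>\<^sup>+x. ?f L x \<partial>M)
        \<le> (\<integral>\<^sup>+x. ennreal (\<Prod>i<L + K. run_max (weighted_exp i) (L + K) x powr p * s i x powr (p / ps i)) \<partial>M)"
        by (intro nn_integral_mono_AE, use weighted_exp_ge in eventually_elim)
          (auto intro!: ennreal_leI mult_right_mono run_prod_le prod_nonneg simp: prod.distrib)
    qed
  qed
  show ?thesis
  proof (rule nn_integral_le_of_tendsto[OF _ _ run_prod_int tendsto_const])
    have "AE x in M. (\<lambda>K. ennreal (run_prod K x) * ennreal (dens x)) \<longlonglongrightarrow> (SUP K. ennreal (run_prod K x)) * ennreal (dens x)"
      using weighted_exp_ge
    proof eventually_elim
      case (elim x)
      have "incseq (\<lambda>K. ennreal (run_prod K x) * ennreal (dens x))"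
        using elim by (auto simp: incseq_def intro!: mult_right_mono ennreal_leI run_prod_mono)
      from LIMSEQ_SUP[OF this] show ?case by (simp add: SUP_mult_right_ennreal)
    qed
    moreover have "AE x in M. (SUP K. ennreal (run_prod K x)) = (SUP n. prod_powr n x)"
      using weighted_exp_ge
    proof eventually_elim
      case (elim x)
      have "(SUP K. ennreal (run_prod K x)) \<le> (SUP n. prod_powr n x)"
      proof (rule SUP_least)
        fix K
        have *: "ennreal (\<Prod>i<K. weighted_exp i k x powr p) \<le> (SUP n. prod_powr n x)" for k
          unfolding prod_powr_def by (intro SUP_upper2[of k UNIV] SUP_upper2[of K UNIV]) auto
        have "ennreal (run_max (\<lambda>k x. \<Prod>i<K. weighted_exp i k x powr p) n x) \<le> (SUP n. prod_powr n x)" for n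
          by (induction n) (use * in \<open>auto simp: max_def\<close>)
        then show "ennreal (run_prod K x) \<le> (SUP n. prod_powr n x)" unfolding run_prod_def .
      qed
      with prod_powr_le_run_prod[of x] elim show ?case by (intro antisym) auto
    qed
    ultimately show "AE x in M. (\<lambda>K. ennreal (run_prod K x) * ennreal (dens x)) \<longlonglongrightarrow> (SUP n. prod_powr n x) * ennreal (dens x)"
      by eventually_elim simp
  qed measurable
qed

text \<open>
  Finiteness matters even where the product of the conditional expectations of the weights
  vanishes, because a limit of the form \<open>0 \<cdot> \<infinity>\<close> would not be controlled.
\<close>

lemma sup_prod_powr_finite: "AE x in M. (SUP n. prod_powr n x) \<noteq> \<top>"
proof -
  obtain B where B: "0 < B" "\<And>N. (\<Prod>i<N. ps i / (ps i - 1)) \<le> B"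
    using prod_conj_exp_bounded[OF ps sums_summable[OF ps_sums]] by metis
  have "AE x in M. (SUP n. prod_powr n x) * ennreal (dens x) \<noteq> \<infinity>"
  proof (rule nn_integral_PInf_AE)
    show "(\<integral>\<^sup>+x. (SUP n. prod_powr n x) * ennreal (dens x) \<partial>M) \<noteq> \<infinity>"
      using sup_prod_powr_bound[OF B] by (auto simp: top_unique)
  qed measurable
  with dens_lim show ?thesis by eventually_elim (auto simp: ennreal_mult_eq_top_iff)
qed

definition cond_prod :: "nat \<Rightarrow> 'a \<Rightarrow> real" where "cond_prod n x = iprod (\<lambda>i. cond_s n i x)"

lemma cond_prod_meas [measurable]: "cond_prod n \<in> borel_measurable M"
  unfolding cond_prod_def[abs_def] iprod_def by measurable

text \<open>
  Domination by the convergent products of \<open>t i\<close>, of the weighted martingales and of the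
  conditional expectations of the weights shows that the product defining the maximal function
  converges, so that its value \<open>iprod\<close> is the intended limit, and gives the bound.
\<close>

lemma doob_product_le:
  fixes h :: "nat \<Rightarrow> 'a \<Rightarrow> real"
  assumes h [measurable]: "\<And>i. h i \<in> borel_measurable M" and t: "\<And>i. 0 \<le> t i"
    and h_le: "\<And>i. AE x in M. \<bar>h i x\<bar> \<le> t i * (u i x * s i x)" and \<tau>: "(\<lambda>N. \<Prod>i<N. t i) \<longlonglongrightarrow> \<tau>"
  shows "AE x in M. ennpowr (doob_max M F h x) p
    \<le> ennreal (\<tau> powr p) * (SUP n. ennreal (cond_prod n x powr p) * prod_powr n x)"
proof -
  have "AE x in M. \<forall>i n. \<bar>real_cond_exp M (F n) (h i) x\<bar>
      \<le> t i * real_cond_exp M (F n) (\<lambda>x. u i x * s i x) x"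
    unfolding AE_all_countable
  proof (intro allI)
    fix i n
    interpret sigma_finite_subalgebra M "F n" by (rule sfs)
    have hi: "integrable M (h i)"
      by (rule Bochner_Integration.integrable_bound[OF integrable_mult_right[OF us_int[of i], of "t i"]])
        (use h_le[of i] in \<open>auto elim!: eventually_mono\<close>)
    have ti: "integrable M (\<lambda>x. t i * (u i x * s i x))" by (intro integrable_mult_right us_int)
    have "AE x in M. h i x \<le> t i * (u i x * s i x)"
      using h_le[of i] by eventually_elim simp
    note 1 = real_cond_exp_mono[OF this hi ti]
    have "AE x in M. - 1 * h i x \<le> t i * (u i x * s i x)"
      using h_le[of i] by eventually_elim simp
    note 2 = real_cond_exp_mono[OF this integrable_mult_right[OF hi] ti]
    show "AE x in M. \<bar>real_cond_exp M (F n) (h i) x\<bar>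
        \<le> t i * real_cond_exp M (F n) (\<lambda>x. u i x * s i x) x"
      using 1 2 real_cond_exp_cmult[OF us_int[of i], of "t i"] real_cond_exp_cmult[OF hi, of "- 1"]
      by eventually_elim simp
  qed
  then show ?thesis using cond_exp_us weighted_exp_ge cond_s_nonneg cond_s_prod_convergent sup_prod_powr_finite
  proof eventually_elim
    case (elim x)
    have X1: "1 \<le> weighted_exp i n x" and X0: "0 \<le> weighted_exp i n x" for i n
      using elim(3) by (auto intro: order_trans[OF zero_le_one])
    show ?case
      unfolding doob_max_def
    proof (rule ennpowr_SUP_le[OF p])
      fix n
      let ?c = "\<lambda>i. \<bar>real_cond_exp M (F n) (h i) x\<bar>"
      have "prod_powr n x \<le> (SUP n. prod_powr n x)" by (rule SUP_upper) simp
      with elim(6) obtain r where r: "0 \<le> r" "prod_powr n x = ennreal r"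
        by (cases "prod_powr n x") (auto simp: top_unique)
      have "(\<lambda>k. ennreal (\<Prod>i<k. weighted_exp i n x powr p)) \<longlonglongrightarrow> ennreal r"
        unfolding r(2)[symmetric] prod_powr_def
        by (rule LIMSEQ_SUP) (use incseq_prod_weighted_exp[OF X1] in \<open>auto simp: incseq_def intro: ennreal_leI\<close>)
      then have "(\<lambda>k. \<Prod>i<k. weighted_exp i n x powr p) \<longlonglongrightarrow> r"
        using r by (subst (asm) tendsto_ennreal_iff) (auto intro!: always_eventually prod_nonneg)
      from iprod_powr[OF _ this, of "1 / p"]
      have R: "(\<lambda>k. \<Prod>i<k. weighted_exp i n x) \<longlonglongrightarrow> r powr (1 / p)"
        using p X0 by (simp add: powr_powr)
      have A: "(\<lambda>k. \<Prod>i<k. cond_s n i x) \<longlonglongrightarrow> cond_prod n x"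
        unfolding cond_prod_def using elim(5) by (intro iprod_lim) simp
      have A0: "0 \<le> cond_prod n x"
        by (rule LIMSEQ_le_const[OF A]) (use elim(4) in \<open>auto intro!: prod_nonneg\<close>)
      have \<tau>0: "0 \<le> \<tau>"
        by (rule LIMSEQ_le_const[OF \<tau>]) (use t in \<open>auto intro!: prod_nonneg\<close>)
      have lim: "(\<lambda>k. \<Prod>i<k. t i * (weighted_exp i n x * cond_s n i x)) \<longlonglongrightarrow> \<tau> * (r powr (1 / p) * cond_prod n x)"
        unfolding prod.distrib by (intro tendsto_mult \<tau> R A)
      have le: "?c i \<le> t i * (weighted_exp i n x * cond_s n i x)" for i using elim(1,2) by simp
      have "iprod ?c powr p \<le> (\<tau> * (r powr (1 / p) * cond_prod n x)) powr p"
        using p prod_partial_dominated(2,3)[OF _ le lim] by (intro powr_mono2) auto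
      also have "\<dots> = \<tau> powr p * (cond_prod n x powr p * r)"
        using p r A0 \<tau>0 by (simp add: powr_mult powr_powr)
      finally have "ennreal (iprod ?c powr p) \<le> ennreal (\<tau> powr p) * (ennreal (cond_prod n x powr p) * prod_powr n x)"
        using r by (simp add: ennreal_leI flip: ennreal_mult)
      also have "\<dots> \<le> ennreal (\<tau> powr p) * (SUP n. ennreal (cond_prod n x powr p) * prod_powr n x)"
        by (intro mult_left_mono SUP_upper) auto
      finally show "ennpowr (ennreal (iprod ?c)) p
          \<le> ennreal (\<tau> powr p) * (SUP n. ennreal (cond_prod n x powr p) * prod_powr n x)"
        using prod_partial_dominated(2)[OF _ le lim] by (simp add: ennpowr_ennreal)
    qed
  qed
qed

end

section \<open>From the testing condition to the full inequality\<close>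

context sigma_family
begin

text \<open>
  Both conditional expectations agree on \<open>A\<close>, as the functions agree there and \<open>A\<close> belongs to \<open>F n\<close>.
\<close>

lemma cond_s_restrict:
  assumes A: "A \<in> sets (F n)" and D: "D \<in> sets M" "A \<subseteq> D"
  shows "AE x in M. \<forall>i. x \<in> A \<longrightarrow>
    \<bar>real_cond_exp M (F n) (\<lambda>y. s i y * indicator D y) x\<bar> = cond_s n i x"
  unfolding AE_all_countable
proof
  fix i
  have A' [measurable]: "A \<in> sets (F n)" "A \<in> sets M" using A subalg[of n] by (auto simp: subalgebra_def)
  interpret sigma_finite_subalgebra M "F n" by (rule sfs)
  note D(1)[measurable]
  have i1: "integrable M (\<lambda>x. indicator A x * s i x)"
    using integrable_mult_indicator[OF A'(2) s_int[of i]] by simp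
  have eq: "indicator A x * (s i x * indicator D x) = indicator A x * s i x" for x
    using D(2) by (auto split: split_indicator)
  have "AE x in M. real_cond_exp M (F n) (\<lambda>x. indicator A x * (s i x * indicator D x)) x
      = indicator A x * real_cond_exp M (F n) (\<lambda>x. s i x * indicator D x) x"
    by (rule real_cond_exp_mult) (use i1 in \<open>simp_all add: eq\<close>)
  moreover have "AE x in M. real_cond_exp M (F n) (\<lambda>x. indicator A x * s i x) x
      = indicator A x * real_cond_exp M (F n) (s i) x"
    by (rule real_cond_exp_mult) (use i1 in simp_all)
  ultimately show "AE x in M. x \<in> A \<longrightarrow>
      \<bar>real_cond_exp M (F n) (\<lambda>y. s i y * indicator D y) x\<bar> = cond_s n i x"
    using cond_s_nonneg unfolding eq
  proof eventually_elim
    case (elim x)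
    show ?case
    proof
      assume "x \<in> A"
      then have "real_cond_exp M (F n) (\<lambda>y. s i y * indicator D y) x = cond_s n i x"
        using elim(1,2) by (simp add: cond_s_def)
      moreover have "0 \<le> cond_s n i x" using elim(3) by simp
      ultimately show "\<bar>real_cond_exp M (F n) (\<lambda>y. s i y * indicator D y) x\<bar> = cond_s n i x" by simp
    qed
  qed
qed

end

context doob_estimate
begin

text \<open>
  Cut into levels \<open>l\<close>, the left-hand side is at most the integral over \<open>l\<close> of the functions
  \<open>b l\<close>, each of which the testing condition for the entry time of the level \<open>l\<close> controls.
\<close>

lemma testing_imp_bound:
  fixes v :: "'a \<Rightarrow> real"
  assumes v [measurable]: "v \<in> borel_measurable M"
    and test: "\<And>\<tau>. ext_stopping_time F \<tau> \<Longrightarrow>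
      (\<integral>\<^sup>+x\<in>fin_set M \<tau>. ennpowr (doob_max M F (\<lambda>i y. s i y * indicator (fin_set M \<tau>) y) x) p
          * ennreal (v x) \<partial>M)
        \<le> ennreal C * (\<integral>\<^sup>+x\<in>fin_set M \<tau>. ennreal (dens x) \<partial>M)"
  shows "(\<integral>\<^sup>+x. (SUP n. ennreal (cond_prod n x powr p) * prod_powr n x) * ennreal (v x) \<partial>M)
    \<le> ennreal C * (\<integral>\<^sup>+x. (SUP n. prod_powr n x) * ennreal (dens x) \<partial>M)"
proof -
  interpret L: pair_sigma_finite M lborel ..
  define pos where "pos l = (indicator {0<..} l :: ennreal)" for l :: real
  have [measurable]: "pos \<in> borel_measurable lborel" unfolding pos_def[abs_def] by measurable
  \<comment> \<open>The supremum of \<open>a\<^sub>n\<close> over the times at which the product exceeds the level \<open>l\<close>, jointly measurable in \<open>x\<close> and \<open>l\<close>.\<close>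
  define b where "b l x = (SUP n. (if ennreal l < prod_powr n x then ennreal (cond_prod n x powr p) else 0))" for l x
  have b_meas [measurable]: "(\<lambda>(x, l). b l x) \<in> borel_measurable (M \<Otimes>\<^sub>M lborel)"
    unfolding b_def[abs_def] by measurable
  have level: "(\<integral>\<^sup>+x. b l x * ennreal (v x) \<partial>M)
      \<le> ennreal C * (\<integral>\<^sup>+x. ennreal (dens x) * indicator {x. ennreal l < (SUP n. prod_powr n x)} x \<partial>M)" for l
  proof -
    define \<tau> where "\<tau> x = (if \<exists>n. ennreal l < prod_powr n x then enat (LEAST n. ennreal l < prod_powr n x) else \<infinity>)" for x
    define D where "D = fin_set M \<tau>"
    have D_eq: "D = {x \<in> space M. \<exists>n. ennreal l < prod_powr n x}"
      unfolding D_def \<tau>_def[abs_def] by (rule fin_set_first_entry)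
    have D_meas: "D \<in> sets M" unfolding D_eq by measurable
    have "ext_stopping_time F \<tau>"
      unfolding \<tau>_def[abs_def]
    proof (rule ext_stopping_time_first_entry[OF subF])
      fix n
      have [measurable]: "prod_powr n \<in> borel_measurable (F n)" by (rule prod_powr_measF)
      show "Measurable.pred (F n) (\<lambda>x. ennreal l < prod_powr n x)" by measurable
    qed
    note test' = test[OF this, folded D_def]
    define A where "A n = {x \<in> space M. ennreal l < prod_powr n x}" for n
    have A_sets: "A n \<in> sets (F n)" for n
    proof -
      have [measurable]: "prod_powr n \<in> borel_measurable (F n)" by (rule prod_powr_measF)
      have "A n = {x \<in> space (F n). ennreal l < prod_powr n x}"
        using subalg[of n] by (simp add: A_def subalgebra_def)
      also have "\<dots> \<in> sets (F n)" by measurable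
      finally show ?thesis .
    qed
    have "AE x in M. \<forall>n i. x \<in> A n \<longrightarrow>
        \<bar>real_cond_exp M (F n) (\<lambda>y. s i y * indicator D y) x\<bar> = cond_s n i x"
      unfolding AE_all_countable[where 'i = nat and P = "\<lambda>n x. \<forall>i. _ n i x"]
      by (intro allI cond_s_restrict A_sets D_meas) (auto simp: A_def D_eq)
    then have "AE x in M. b l x
        \<le> ennpowr (doob_max M F (\<lambda>i y. s i y * indicator D y) x) p * indicator D x"
      using cond_s_nonneg cond_s_prod_convergent AE_space
    proof eventually_elim
      case (elim x)
      show ?case unfolding b_def
      proof (rule SUP_least)
        fix n
        show "(if ennreal l < prod_powr n x then ennreal (cond_prod n x powr p) else 0)
            \<le> ennpowr (doob_max M F (\<lambda>i y. s i y * indicator D y) x) p * indicator D x"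
        proof (cases "ennreal l < prod_powr n x")
          case True
          then have xA: "x \<in> A n" and xD: "x \<in> D" using elim(4) by (auto simp: A_def D_eq)
          have "cond_prod n x = iprod (\<lambda>i. \<bar>real_cond_exp M (F n) (\<lambda>y. s i y * indicator D y) x\<bar>)"
            using elim(1) xA by (simp add: cond_prod_def)
          then have le: "ennreal (cond_prod n x) \<le> doob_max M F (\<lambda>i y. s i y * indicator D y) x"
            unfolding doob_max_def by (auto intro: SUP_upper)
          have lim: "(\<lambda>k. \<Prod>i<k. cond_s n i x) \<longlonglongrightarrow> cond_prod n x"
            unfolding cond_prod_def using elim(3) by (intro iprod_lim) simp
          have "0 \<le> cond_prod n x"
            by (rule LIMSEQ_le_const[OF lim]) (use elim(2) in \<open>auto intro!: prod_nonneg\<close>)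
          then have "ennreal (cond_prod n x powr p) = ennpowr (ennreal (cond_prod n x)) p"
            by (simp add: ennpowr_ennreal)
          also have "\<dots> \<le> ennpowr (doob_max M F (\<lambda>i y. s i y * indicator D y) x) p"
            using le p by (intro ennpowr_mono) auto
          finally show ?thesis using True xD by simp
        qed simp
      qed
    qed
    then have "(\<integral>\<^sup>+x. b l x * ennreal (v x) \<partial>M)
        \<le> (\<integral>\<^sup>+x\<in>D. ennpowr (doob_max M F (\<lambda>i y. s i y * indicator D y) x) p * ennreal (v x) \<partial>M)"
      by (intro nn_integral_mono_AE, elim eventually_mono)
        (metis (no_types, lifting) mult.assoc mult.commute mult_right_mono zero_le)
    also have "\<dots> \<le> ennreal C * (\<integral>\<^sup>+x\<in>D. ennreal (dens x) \<partial>M)" by (rule test')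
    also have "(\<integral>\<^sup>+x\<in>D. ennreal (dens x) \<partial>M)
        = (\<integral>\<^sup>+x. ennreal (dens x) * indicator {x. ennreal l < (SUP n. prod_powr n x)} x \<partial>M)"
      by (intro nn_integral_cong) (auto simp: D_eq less_SUP_iff split: split_indicator)
    finally show ?thesis .
  qed
  have "(SUP n. ennreal (cond_prod n x powr p) * prod_powr n x) \<le> (\<integral>\<^sup>+l. pos l * b l x \<partial>lborel)" for x
  proof (rule SUP_least)
    fix n
    have "ennreal (cond_prod n x powr p) * prod_powr n x
        = (\<integral>\<^sup>+l. ennreal (cond_prod n x powr p) * indicator {l. 0 < l \<and> ennreal l < prod_powr n x} l \<partial>lborel)"
      by (subst nn_integral_cmult) (simp_all add: nn_integral_indicator_less)
    also have "\<dots> \<le> (\<integral>\<^sup>+l. pos l * b l x \<partial>lborel)"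
    proof (rule nn_integral_mono)
      fix l
      show "ennreal (cond_prod n x powr p) * indicator {l. 0 < l \<and> ennreal l < prod_powr n x} l \<le> pos l * b l x"
        unfolding b_def pos_def
        by (rule order_trans[OF _ mult_left_mono[OF SUP_upper[of n]]]) (auto split: split_indicator)
    qed
    finally show "ennreal (cond_prod n x powr p) * prod_powr n x \<le> (\<integral>\<^sup>+l. pos l * b l x \<partial>lborel)" .
  qed
  then have "(\<integral>\<^sup>+x. (SUP n. ennreal (cond_prod n x powr p) * prod_powr n x) * ennreal (v x) \<partial>M)
      \<le> (\<integral>\<^sup>+x. (\<integral>\<^sup>+l. pos l * b l x \<partial>lborel) * ennreal (v x) \<partial>M)"
    by (intro nn_integral_mono mult_right_mono) auto
  also have "\<dots> = (\<integral>\<^sup>+x. (\<integral>\<^sup>+l. pos l * (b l x * ennreal (v x)) \<partial>lborel) \<partial>M)"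
    by (intro nn_integral_cong, subst nn_integral_multc[symmetric]) (auto simp: mult.assoc)
  also have "\<dots> = (\<integral>\<^sup>+l. (\<integral>\<^sup>+x. pos l * (b l x * ennreal (v x)) \<partial>M) \<partial>lborel)"
    by (rule L.Fubini'[symmetric]) measurable
  also have "\<dots> = (\<integral>\<^sup>+l. pos l * (\<integral>\<^sup>+x. b l x * ennreal (v x) \<partial>M) \<partial>lborel)"
    by (intro nn_integral_cong nn_integral_cmult) measurable
  also have "\<dots> \<le> (\<integral>\<^sup>+l. pos l * (ennreal C
      * (\<integral>\<^sup>+x. ennreal (dens x) * indicator {x. ennreal l < (SUP n. prod_powr n x)} x \<partial>M)) \<partial>lborel)"
    by (intro nn_integral_mono mult_left_mono level) auto
  also have "\<dots> = ennreal C * (\<integral>\<^sup>+l. (\<integral>\<^sup>+x. ennreal (dens x)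
      * indicator {l. 0 < l \<and> ennreal l < (SUP n. prod_powr n x)} l \<partial>M) \<partial>lborel)"
  proof -
    have "pos l * (ennreal C * (\<integral>\<^sup>+x. ennreal (dens x) * indicator {x. ennreal l < (SUP n. prod_powr n x)} x \<partial>M))
      = ennreal C * (\<integral>\<^sup>+x. ennreal (dens x) * indicator {l. 0 < l \<and> ennreal l < (SUP n. prod_powr n x)} l \<partial>M)" for l
      by (cases "0 < l") (auto simp: pos_def indicator_def)
    then show ?thesis by (simp add: nn_integral_cmult)
  qed
  also have "(\<integral>\<^sup>+l. (\<integral>\<^sup>+x. ennreal (dens x)
      * indicator {l. 0 < l \<and> ennreal l < (SUP n. prod_powr n x)} l \<partial>M) \<partial>lborel)
    = (\<integral>\<^sup>+x. (\<integral>\<^sup>+l. ennreal (dens x)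
      * indicator {l. 0 < l \<and> ennreal l < (SUP n. prod_powr n x)} l \<partial>lborel) \<partial>M)"
    by (rule L.Fubini') (simp add: indicator_def)
  also have "\<dots> = (\<integral>\<^sup>+x. (SUP n. prod_powr n x) * ennreal (dens x) \<partial>M)"
    by (intro nn_integral_cong, subst nn_integral_cmult)
      (simp_all add: nn_integral_indicator_less mult.commute)
  finally show ?thesis .
qed

end

context sigma_family
begin

text \<open>
  Normalisation of the functions \<open>g i\<close>.  The powers of \<open>mass_prod\<close> that it introduces cancel
  those in the bound for the supremum of the martingale products.
\<close>

lemma two_weight_bound:
  fixes v :: "'a \<Rightarrow> real" and g :: "nat \<Rightarrow> 'a \<Rightarrow> real"
  assumes v [measurable]: "v \<in> borel_measurable M" and C: "0 \<le> C"
    and test: "\<And>\<tau>. ext_stopping_time F \<tau> \<Longrightarrow>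
      (\<integral>\<^sup>+x\<in>fin_set M \<tau>. ennpowr (doob_max M F (\<lambda>i y. s i y * indicator (fin_set M \<tau>) y) x) p
          * ennreal (v x) \<partial>M)
        \<le> ennreal C * (\<integral>\<^sup>+x\<in>fin_set M \<tau>. ennreal (dens x) \<partial>M)"
    and B: "0 < B" "\<And>N. (\<Prod>i<N. ps i / (ps i - 1)) \<le> B"
    and g: "\<And>i. g i \<in> Lw M (ps i) (s i)"
    and conv: "iprod_finite (\<lambda>i. Lw_norm M (ps i) (s i) (g i))"
  shows "eLw_norm M p v (doob_max M F (\<lambda>i x. g i x * s i x))
    \<le> ennreal ((2 * C) powr (1 / p) * B * iprod (\<lambda>i. Lw_norm M (ps i) (s i) (g i)))"
proof -
  define G where "G i = Lw_norm M (ps i) (s i) (g i)" for i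
  define \<gamma> where "\<gamma> = iprod G"
  have G0: "0 \<le> G i" for i by (simp add: G_def Lw_norm_def)
  have \<gamma>: "(\<lambda>N. \<Prod>i<N. G i) \<longlonglongrightarrow> \<gamma>"
    unfolding \<gamma>_def using conv by (intro iprod_lim) (simp add: iprod_finite_def G_def)
  have \<gamma>0: "0 \<le> \<gamma>" by (rule LIMSEQ_le_const[OF \<gamma>]) (auto intro!: prod_nonneg G0)
  have g_meas [measurable]: "g i \<in> borel_measurable M"
    and g_int: "integrable M (\<lambda>x. \<bar>g i x\<bar> powr ps i * s i x)" for i
    using g[of i] by (auto simp: Lw_def)
  have Gp: "G i powr ps i = (\<integral>x. \<bar>g i x\<bar> powr ps i * s i x \<partial>M)" for i
    using ps_pos[of i] s_nonneg[of i]
    by (simp add: G_def Lw_norm_def powr_powr less_imp_neq[symmetric] integral_nonneg_AE)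
  define t where "t i = G i / mass i powr (1 / ps i)" for i
  have t0: "0 \<le> t i" for i by (simp add: t_def G0)
  have t_iff: "t i = 0 \<longleftrightarrow> G i = 0" for i using mass_pos[of i] by (simp add: t_def)
  have tp: "t i powr ps i = G i powr ps i / mass i" for i
    using mass_pos[of i] ps_pos[of i] G0[of i]
    by (simp add: t_def powr_divide powr_powr less_imp_neq[symmetric])
  \<comment> \<open>If \<open>t i = 0\<close>, then \<open>g i\<close> vanishes almost everywhere, and \<open>u i = 1\<close> by the convention \<open>x / 0 = 0\<close>.\<close>
  define u where "u i x = max 1 (\<bar>g i x\<bar> / t i)" for i x
  have u_meas [measurable]: "u i \<in> borel_measurable M" for i unfolding u_def[abs_def] by measurable
  have up: "u i x powr ps i * s i x \<le> s i x + (\<bar>g i x\<bar> powr ps i * s i x) / t i powr ps i" for i x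
  proof -
    have "u i x powr ps i \<le> 1 + (\<bar>g i x\<bar> / t i) powr ps i"
      by (auto simp: u_def max_def)
    also have "(\<bar>g i x\<bar> / t i) powr ps i = \<bar>g i x\<bar> powr ps i / t i powr ps i"
      by (simp add: powr_divide t0)
    finally have "u i x powr ps i * s i x \<le> (1 + \<bar>g i x\<bar> powr ps i / t i powr ps i) * s i x"
      by (intro mult_right_mono s_nonneg)
    then show ?thesis by (simp add: algebra_simps)
  qed
  have dom: "integrable M (\<lambda>x. s i x + (\<bar>g i x\<bar> powr ps i * s i x) / t i powr ps i)" for i
    by (intro Bochner_Integration.integrable_add s_int integrable_divide g_int)
  have u_int: "integrable M (\<lambda>x. u i x powr ps i * s i x)" for i
    by (rule Bochner_Integration.integrable_bound[OF dom[of i]])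
      (auto intro!: AE_I2 order_trans[OF up] simp: abs_mult s_nonneg)
  interpret doob_estimate M F p ps s u
  proof
    fix i
    show "u i \<in> borel_measurable M" by measurable
    show "1 \<le> u i x" for x by (simp add: u_def)
    show "integrable M (\<lambda>x. u i x powr ps i * s i x)" by (rule u_int)
    have "(\<integral>x. u i x powr ps i * s i x \<partial>M)
        \<le> (\<integral>x. s i x + (\<bar>g i x\<bar> powr ps i * s i x) / t i powr ps i \<partial>M)"
      by (intro integral_mono u_int dom up)
    also have "\<dots> = mass i + G i powr ps i / t i powr ps i"
      by (subst Bochner_Integration.integral_add) (simp_all add: s_int g_int mass_def Gp)
    also have "\<dots> \<le> 2 * mass i"
      using mass_pos[of i] by (cases "G i = 0") (simp_all add: tp)
    finally show "(\<integral>x. u i x powr ps i * s i x \<partial>M) \<le> 2 * mass i" .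
  qed
  have h_le: "AE x in M. \<bar>g i x * s i x\<bar> \<le> t i * (u i x * s i x)" for i
  proof (cases "t i = 0")
    case True
    then have "(\<integral>x. \<bar>g i x\<bar> powr ps i * s i x \<partial>M) = 0" using t_iff[of i] Gp[of i] by simp
    then have "AE x in M. \<bar>g i x\<bar> powr ps i * s i x = 0"
      using integral_nonneg_eq_0_iff_AE[OF g_int[of i]] s_nonneg by simp
    then show ?thesis by eventually_elim (auto simp: True)
  next
    case False
    then have "0 < t i" using t0[of i] by simp
    have "\<bar>g i x * s i x\<bar> \<le> t i * (u i x * s i x)" for x
    proof -
      have "\<bar>g i x\<bar> = t i * (\<bar>g i x\<bar> / t i)" using \<open>0 < t i\<close> by simp
      also have "\<dots> \<le> t i * u i x" using t0 by (intro mult_left_mono) (simp_all add: u_def)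
      finally have "\<bar>g i x\<bar> * s i x \<le> t i * u i x * s i x"
        by (intro mult_right_mono s_nonneg)
      then show ?thesis by (simp add: abs_mult s_nonneg mult.assoc)
    qed
    then show ?thesis by simp
  qed
  have \<tau>: "(\<lambda>N. \<Prod>i<N. t i) \<longlonglongrightarrow> \<gamma> / mass_prod"
    unfolding t_def prod_dividef using mass_prod_pos by (intro tendsto_divide \<gamma> mass_lim) simp
  have "(\<integral>\<^sup>+x. ennpowr (doob_max M F (\<lambda>i x. g i x * s i x) x) p * ennreal (v x) \<partial>M)
      \<le> (\<integral>\<^sup>+x. ennreal ((\<gamma> / mass_prod) powr p) * (SUP n. ennreal (cond_prod n x powr p) * prod_powr n x) * ennreal (v x) \<partial>M)"
    using doob_product_le[of "\<lambda>i x. g i x * s i x", OF _ t0 h_le \<tau>]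
    by (intro nn_integral_mono_AE) (auto elim!: eventually_mono intro: mult_right_mono)
  also have "\<dots> = ennreal ((\<gamma> / mass_prod) powr p)
      * (\<integral>\<^sup>+x. (SUP n. ennreal (cond_prod n x powr p) * prod_powr n x) * ennreal (v x) \<partial>M)"
    by (simp add: mult.assoc nn_integral_cmult)
  also have "\<dots> \<le> ennreal ((\<gamma> / mass_prod) powr p) * (ennreal C * ennreal (2 * B powr p * mass_prod powr p))"
    by (intro mult_left_mono order_trans[OF testing_imp_bound[OF v test]] sup_prod_powr_bound[OF B]) auto
  also have "\<dots> = ennreal (((2 * C) powr (1 / p) * B * \<gamma>) powr p)"
    using C B mass_prod_pos p \<gamma>0
    by (simp add: powr_mult powr_divide powr_powr field_simps flip: ennreal_mult)
  finally have "eLw_norm M p v (doob_max M F (\<lambda>i x. g i x * s i x))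
      \<le> ennpowr (ennreal (((2 * C) powr (1 / p) * B * \<gamma>) powr p)) (1 / p)"
    unfolding eLw_norm_def using p by (intro ennpowr_mono) auto
  also have "\<dots> = ennreal ((2 * C) powr (1 / p) * B * \<gamma>)"
    using p B \<gamma>0 by (simp add: ennpowr_ennreal powr_powr)
  finally show ?thesis by (simp add: \<gamma>_def G_def[abs_def])
qed

text \<open>
  Restricting to \<open>D\<close> decreases each factor of a convergent product.
\<close>

lemma restricted_mass_conv:
  assumes D: "D \<in> sets M"
  shows "convergent (\<lambda>N. \<Prod>i<N. wmeas M (s i) D powr (1 / ps i))"
proof -
  have 0: "0 \<le> wmeas M (s i) D" for i
    by (simp add: wmeas_def set_lebesgue_integral_def s_nonneg)
  have le: "wmeas M (s i) D \<le> mass i" for i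
    unfolding wmeas_def set_lebesgue_integral_def mass_def
    using integrable_mult_indicator[OF D s_int[of i]]
    by (intro integral_mono s_int) (auto simp: s_nonneg split: split_indicator)
  show "convergent (\<lambda>N. \<Prod>i<N. wmeas M (s i) D powr (1 / ps i))"
    by (rule prod_partial_dominated(1)[OF _ _ mass_lim])
      (auto intro!: powr_mono2 le 0 simp: ps_pos less_imp_le)
qed

end

text \<open>
  The reverse Hoelder condition turns the product of masses in the testing condition, which is
  not additive in the set, into an integral over the set.
\<close>

lemma (in sigma_family) testing_of_S_class_RH:
  fixes C3 CR :: real
  assumes \<tau>: "ext_stopping_time F \<tau>" and C: "0 < C3" "0 < CR"
    and S: "ennpowr (\<integral>\<^sup>+x\<in>fin_set M \<tau>.
          ennpowr (doob_max M F (\<lambda>i y. s i y * indicator (fin_set M \<tau>) y) x) p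
            * ennreal (v x) \<partial>M) (1 / p)
      \<le> ennreal (C3 * iprod (\<lambda>i. wmeas M (s i) (fin_set M \<tau>) powr (1 / ps i)))"
    and R: "ennreal (iprod (\<lambda>i. (LINT x:fin_set M \<tau>|M. s i x) powr (p / ps i)))
      \<le> ennreal CR * (\<integral>\<^sup>+x\<in>fin_set M \<tau>. ennreal (iprod (\<lambda>i. s i x powr (p / ps i))) \<partial>M)"
  shows "(\<integral>\<^sup>+x\<in>fin_set M \<tau>. ennpowr (doob_max M F (\<lambda>i y. s i y * indicator (fin_set M \<tau>) y) x) p
          * ennreal (v x) \<partial>M)
        \<le> ennreal (C3 powr p * CR) * (\<integral>\<^sup>+x\<in>fin_set M \<tau>. ennreal (dens x) \<partial>M)" (is "?I \<le> _")
proof -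
  let ?D = "fin_set M \<tau>"
  let ?P = "iprod (\<lambda>i. wmeas M (s i) ?D powr (1 / ps i))"
  note D = fin_set_sets[OF subalg \<tau>]
  have P: "(\<lambda>N. \<Prod>i<N. wmeas M (s i) ?D powr (1 / ps i)) \<longlonglongrightarrow> ?P"
    by (rule iprod_lim[OF restricted_mass_conv[OF D]])
  have P0: "0 \<le> ?P" by (rule LIMSEQ_le_const[OF P]) (auto intro!: prod_nonneg)
  have Pp: "iprod (\<lambda>i. wmeas M (s i) ?D powr (p / ps i)) = ?P powr p"
    by (rule iprod_eqI) (use iprod_powr[OF _ P p] in \<open>simp add: powr_powr\<close>)
  have "?I = ennpowr (ennpowr ?I (1 / p)) p" by (simp add: ennpowr_ennpowr' p)
  also have "\<dots> \<le> ennpowr (ennreal (C3 * ?P)) p"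
    by (rule ennpowr_mono[OF S]) (use p in simp)
  also have "\<dots> = ennreal (C3 powr p) * ennreal (iprod (\<lambda>i. wmeas M (s i) ?D powr (p / ps i)))"
    using C P0 by (simp add: ennpowr_ennreal powr_mult Pp flip: ennreal_mult)
  also have "\<dots> \<le> ennreal (C3 powr p) * (ennreal CR * (\<integral>\<^sup>+x\<in>?D. ennreal (dens x) \<partial>M))"
    using R by (intro mult_left_mono) (auto simp: wmeas_def dens_def)
  also have "\<dots> = ennreal (C3 powr p * CR) * (\<integral>\<^sup>+x\<in>?D. ennreal (dens x) \<partial>M)"
    using C by (simp add: ennreal_mult mult.assoc)
  finally show ?thesis .
qed

lemma dual_weight_powr:
  fixes w q :: real
  assumes "0 < w" "1 < q"
  shows "(w powr (1 - conj_exp q)) powr q * w = w powr (1 - conj_exp q)"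
proof -
  have eq: "(1 - conj_exp q) * q + 1 = 1 - conj_exp q"
    using assms by (simp add: conj_exp_def field_simps)
  have "(w powr (1 - conj_exp q)) powr q * w = w powr ((1 - conj_exp q) * q) * w powr 1"
    using assms by (simp add: powr_powr)
  also have "\<dots> = w powr ((1 - conj_exp q) * q + 1)" by (simp only: powr_add)
  finally show ?thesis by (simp only: eq)
qed

lemma weight_pos: "weight M w \<Longrightarrow> AE x in M. 0 < w x"
  by (simp add: weight_def)

lemma
  assumes w: "weight M (w i)" and q: "1 < ps i" and s: "integrable M (sig ps w i)"
    and g: "g \<in> borel_measurable M"
  shows Lw_mult_sig_iff: "(\<lambda>x. g x * sig ps w i x) \<in> Lw M (ps i) (w i) \<longleftrightarrow> g \<in> Lw M (ps i) (sig ps w i)"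
    and Lw_norm_mult_sig: "Lw_norm M (ps i) (w i) (\<lambda>x. g x * sig ps w i x) = Lw_norm M (ps i) (sig ps w i) g"
proof -
  have [measurable]: "w i \<in> borel_measurable M" "sig ps w i \<in> borel_measurable M" "g \<in> borel_measurable M"
    using w s g by (auto simp: weight_def)
  have ae: "AE x in M. \<bar>g x * sig ps w i x\<bar> powr ps i * w i x = \<bar>g x\<bar> powr ps i * sig ps w i x"
    using weight_pos[OF w]
  proof eventually_elim
    case (elim x)
    then show ?case using dual_weight_powr[OF elim q]
      by (simp add: sig_def abs_mult powr_mult mult.assoc)
  qed
  show "(\<lambda>x. g x * sig ps w i x) \<in> Lw M (ps i) (w i) \<longleftrightarrow> g \<in> Lw M (ps i) (sig ps w i)"
    using integrable_cong_AE[OF _ _ ae] by (simp add: Lw_def)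
  show "Lw_norm M (ps i) (w i) (\<lambda>x. g x * sig ps w i x) = Lw_norm M (ps i) (sig ps w i) g"
    unfolding Lw_norm_def by (subst integral_cong_AE[OF _ _ ae]) auto
qed

lemma eLw_norm_doob_max_cong:
  assumes M: "finite_measure M" and sub: "\<And>n. subalgebra M (F n)"
    and f: "\<And>i. f i \<in> borel_measurable M" "\<And>i. h i \<in> borel_measurable M"
    and eq: "\<And>i. AE x in M. f i x = h i x"
  shows "eLw_norm M p v (doob_max M F f) = eLw_norm M p v (doob_max M F h)"
proof -
  have "AE x in M. \<forall>n i. real_cond_exp M (F n) (f i) x = real_cond_exp M (F n) (h i) x"
    unfolding AE_all_countable
    by (intro allI sigma_finite_subalgebra.real_cond_exp_cong sigma_finite_subalgebraI M sub eq f)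
  then have "AE x in M. doob_max M F f x = doob_max M F h x"
    by eventually_elim (simp add: doob_max_def)
  then show ?thesis
    unfolding eLw_norm_def
    by (intro arg_cong2[where f = ennpowr] refl nn_integral_cong_AE) (auto elim: eventually_mono)
qed

theorem theorem1p2:
  fixes M :: "'a measure" and F :: "nat \<Rightarrow> 'a measure"
    and p :: real and ps :: "nat \<Rightarrow> real"
    and w :: "nat \<Rightarrow> 'a \<Rightarrow> real" and v :: "'a \<Rightarrow> real"
  assumes prob: "prob_space M" and compl: "complete_measure M"
    and filt: "filtration (space M) F" and sub: "\<And>n. subalgebra M (F n)"
    and gen: "sets M = sigma_sets (space M) (\<Union>n. sets (F n))"
    and ps: "\<And>i. 1 < ps i" and p: "0 < p" "(\<lambda>i. 1 / ps i) sums (1 / p)"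
    and w: "\<And>i. weight M (w i)" and v: "weight M v"
    and A1: "\<And>i. integrable M (sig ps w i)"
    and A2: "iprod_finite (\<lambda>i. Lw_norm M (ps i) (w i) (sig ps w i))"
    and A3: "\<And>n. AE x in M. iprod_finite
              (\<lambda>i. real_cond_exp M (F n) (\<lambda>y. w i y powr (1 - conj_exp (ps i))) x
                     powr (1 / conj_exp (ps i)))"
    and A4: "AE x in M. iprod_finite (\<lambda>i. sig ps w i x powr (1 / ps i))
                        \<and> iprod (\<lambda>i. sig ps w i x powr (1 / ps i)) > 0"
    and RH: "RH M F p ps w"
  defines "stmt1 \<equiv>
      (\<exists>C>0. \<forall>f. (\<forall>i. f i \<in> Lw M (ps i) (w i) \<and> (AE x in M. 0 \<le> f i x))
          \<and> iprod_finite (\<lambda>i. Lw_norm M (ps i) (w i) (f i)) \<longrightarrow>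
        eLw_norm M p v (doob_max M F f)
          \<le> ennreal (C * iprod (\<lambda>i. Lw_norm M (ps i) (w i) (f i))))"
    and "stmt2 \<equiv>
      (\<exists>C>0. \<forall>g. (\<forall>i. g i \<in> Lw M (ps i) (sig ps w i) \<and> (AE x in M. 0 \<le> g i x))
          \<and> iprod_finite (\<lambda>i. Lw_norm M (ps i) (sig ps w i) (g i)) \<longrightarrow>
        eLw_norm M p v (doob_max M F (\<lambda>i x. g i x * sig ps w i x))
          \<le> ennreal (C * iprod (\<lambda>i. Lw_norm M (ps i) (sig ps w i) (g i))))"
    and "stmt3 \<equiv> S_class M F p ps v w"
  shows "(stmt1 \<longleftrightarrow> stmt2) \<and> (stmt2 \<longleftrightarrow> stmt3)"
proof -
  let ?s = "sig ps w"
  interpret prob_space M by fact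
  have v_meas [measurable]: "v \<in> borel_measurable M" using v by (auto simp: weight_def)
  have w_meas [measurable]: "w i \<in> borel_measurable M" for i using w[of i] by (auto simp: weight_def)
  have s_meas [measurable]: "?s i \<in> borel_measurable M" for i using A1[of i] by auto
  have s_pos: "AE x in M. 0 < ?s i x" for i
    using weight_pos[OF w[of i]] by eventually_elim (simp add: sig_def)
  have s_nonneg: "0 \<le> ?s i x" for i x by (simp add: sig_def)
  have norm_s: "Lw_norm M (ps i) (w i) (?s i) = (\<integral>x. ?s i x \<partial>M) powr (1 / ps i)" for i
    using Lw_norm_mult_sig[OF w ps A1, of "\<lambda>_. 1" i] by (simp add: Lw_norm_def)
  interpret sigma_family M F p ps ?s
  proof
    show "sets (F m) \<subseteq> sets (F n)" if "m \<le> n" for m n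
      using filtration.sets_F_mono[OF filt that] .
    show "convergent (\<lambda>n. \<Prod>i<n. (\<integral>x. ?s i x \<partial>M) powr (1 / ps i))"
      using A2 by (simp add: iprod_finite_def norm_s)
    show "AE x in M. convergent
          (\<lambda>k. \<Prod>i<k. real_cond_exp M (F n) (?s i) x powr (1 / conj_exp (ps i)))" for n
      using A3[of n] by (simp add: iprod_finite_def sig_def[abs_def])
    show "AE x in M. convergent (\<lambda>n. \<Prod>i<n. ?s i x powr (1 / ps i))
          \<and> 0 < iprod (\<lambda>i. ?s i x powr (1 / ps i))"
      using A4 by (simp add: iprod_finite_def)
  qed (fact sub ps p A1 s_nonneg s_pos)+
  have "stmt2" if stmt1
  proof -
    obtain C where C: "0 < C" and *: "\<forall>f. (\<forall>i. f i \<in> Lw M (ps i) (w i) \<and> (AE x in M. 0 \<le> f i x))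
          \<and> iprod_finite (\<lambda>i. Lw_norm M (ps i) (w i) (f i)) \<longrightarrow>
        eLw_norm M p v (doob_max M F f) \<le> ennreal (C * iprod (\<lambda>i. Lw_norm M (ps i) (w i) (f i)))"
      using \<open>stmt1\<close> unfolding stmt1_def by blast
    show stmt2 unfolding stmt2_def
    proof (intro exI[of _ C] conjI allI impI C)
      fix g :: "nat \<Rightarrow> 'a \<Rightarrow> real"
      assume g: "(\<forall>i. g i \<in> Lw M (ps i) (?s i) \<and> (AE x in M. 0 \<le> g i x))
            \<and> iprod_finite (\<lambda>i. Lw_norm M (ps i) (?s i) (g i))"
      have g_meas: "g i \<in> borel_measurable M" for i using g by (auto simp: Lw_def)
      have nn: "AE x in M. 0 \<le> g i x * ?s i x" for i
      proof -
        have "AE x in M. 0 \<le> g i x" using g by simp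
        then show ?thesis by eventually_elim (simp add: s_nonneg)
      qed
      note norm = Lw_norm_mult_sig[OF w ps A1 g_meas] and mem = Lw_mult_sig_iff[OF w ps A1 g_meas]
      show "eLw_norm M p v (doob_max M F (\<lambda>i x. g i x * ?s i x))
            \<le> ennreal (C * iprod (\<lambda>i. Lw_norm M (ps i) (?s i) (g i)))"
        using *[rule_format, of "\<lambda>i x. g i x * ?s i x"] g nn by (simp add: norm mem)
    qed
  qed
  moreover have "stmt1" if stmt2
  proof -
    obtain C where C: "0 < C" and *: "\<forall>g. (\<forall>i. g i \<in> Lw M (ps i) (?s i) \<and> (AE x in M. 0 \<le> g i x))
          \<and> iprod_finite (\<lambda>i. Lw_norm M (ps i) (?s i) (g i)) \<longrightarrow>
        eLw_norm M p v (doob_max M F (\<lambda>i x. g i x * ?s i x))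
          \<le> ennreal (C * iprod (\<lambda>i. Lw_norm M (ps i) (?s i) (g i)))"
      using \<open>stmt2\<close> unfolding stmt2_def by blast
    show stmt1 unfolding stmt1_def
    proof (intro exI[of _ C] conjI allI impI C)
      fix f :: "nat \<Rightarrow> 'a \<Rightarrow> real"
      assume f: "(\<forall>i. f i \<in> Lw M (ps i) (w i) \<and> (AE x in M. 0 \<le> f i x))
            \<and> iprod_finite (\<lambda>i. Lw_norm M (ps i) (w i) (f i))"
      have f_meas [measurable]: "f i \<in> borel_measurable M" for i using f by (auto simp: Lw_def)
      define g where "g i x = f i x / ?s i x" for i x
      have g_meas [measurable]: "g i \<in> borel_measurable M" for i unfolding g_def[abs_def] by measurable
      have eq: "AE x in M. f i x = g i x * ?s i x" for i
        using s_pos[of i] by eventually_elim (simp add: g_def)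
      have nn: "AE x in M. 0 \<le> g i x" for i
      proof -
        have "AE x in M. 0 \<le> f i x" using f by simp
        then show ?thesis by eventually_elim (simp add: g_def s_nonneg)
      qed
      have ae: "AE x in M. \<bar>f i x\<bar> powr ps i * w i x = \<bar>g i x * ?s i x\<bar> powr ps i * w i x" for i
        using eq[of i] by eventually_elim simp
      have "(\<lambda>x. g i x * ?s i x) \<in> Lw M (ps i) (w i)" for i
        using f integrable_cong_AE[OF _ _ ae[of i]] by (simp add: Lw_def)
      then have mem: "g i \<in> Lw M (ps i) (?s i)" for i by (simp add: Lw_mult_sig_iff[OF w ps A1 g_meas])
      have norm: "Lw_norm M (ps i) (w i) (f i) = Lw_norm M (ps i) (?s i) (g i)" for i
        unfolding Lw_norm_mult_sig[OF w ps A1 g_meas, symmetric]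
        unfolding Lw_norm_def by (subst integral_cong_AE[OF _ _ ae]) auto
      have "eLw_norm M p v (doob_max M F f) = eLw_norm M p v (doob_max M F (\<lambda>i x. g i x * ?s i x))"
        by (rule eLw_norm_doob_max_cong[OF finite_measure_axioms sub _ _ eq]) measurable
      then show "eLw_norm M p v (doob_max M F f) \<le> ennreal (C * iprod (\<lambda>i. Lw_norm M (ps i) (w i) (f i)))"
        using *[rule_format, of g] f mem nn by (simp add: norm)
    qed
  qed
  moreover have "stmt3" if stmt2
  proof -
    obtain C where C: "0 < C" and *: "\<forall>g. (\<forall>i. g i \<in> Lw M (ps i) (?s i) \<and> (AE x in M. 0 \<le> g i x))
          \<and> iprod_finite (\<lambda>i. Lw_norm M (ps i) (?s i) (g i)) \<longrightarrow>
        eLw_norm M p v (doob_max M F (\<lambda>i x. g i x * ?s i x))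
          \<le> ennreal (C * iprod (\<lambda>i. Lw_norm M (ps i) (?s i) (g i)))"
      using \<open>stmt2\<close> unfolding stmt2_def by blast
    show stmt3 unfolding stmt3_def S_class_def
    proof (intro exI[of _ C] conjI allI impI C)
      fix \<tau> :: "'a \<Rightarrow> enat"
      assume \<tau>: "ext_stopping_time F \<tau>"
      define D where "D = fin_set M \<tau>"
      have D [measurable]: "D \<in> sets M" unfolding D_def by (rule fin_set_sets[OF sub \<tau>])
      have ind: "(indicator D x :: real) powr ps i = indicator D x" for i x
        by (simp split: split_indicator)
      have mem: "indicator D \<in> Lw M (ps i) (?s i)" for i
        using integrable_mult_indicator[OF D A1[of i]] by (simp add: Lw_def ind)
      have norm: "Lw_norm M (ps i) (?s i) (indicator D) = wmeas M (?s i) D powr (1 / ps i)" for i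
        by (simp add: Lw_norm_def wmeas_def set_lebesgue_integral_def ind)
      have "ennpowr (\<integral>\<^sup>+x\<in>D. ennpowr (doob_max M F (\<lambda>i y. ?s i y * indicator D y) x) p * ennreal (v x) \<partial>M) (1 / p)
          \<le> eLw_norm M p v (doob_max M F (\<lambda>i x. indicator D x * ?s i x))"
        unfolding eLw_norm_def using p
        by (intro ennpowr_mono nn_integral_mono) (auto simp: mult.commute split: split_indicator)
      also have "\<dots> \<le> ennreal (C * iprod (\<lambda>i. wmeas M (?s i) D powr (1 / ps i)))"
        using *[rule_format, of "\<lambda>i. indicator D"] mem restricted_mass_conv[OF D]
        by (simp add: norm iprod_finite_def)
      finally show "ennpowr (\<integral>\<^sup>+x\<in>fin_set M \<tau>. ennpowr (doob_max M F
            (\<lambda>i y. ?s i y * indicator (fin_set M \<tau>) y) x) p * ennreal (v x) \<partial>M) (1 / p)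
        \<le> ennreal (C * iprod (\<lambda>i. wmeas M (?s i) (fin_set M \<tau>) powr (1 / ps i)))"
        unfolding D_def .
    qed
  qed
  moreover have "stmt2" if stmt3
  proof -
    obtain C3 where C3: "0 < C3" and S: "\<And>\<tau>. ext_stopping_time F \<tau> \<Longrightarrow>
        ennpowr (\<integral>\<^sup>+x\<in>fin_set M \<tau>.
          ennpowr (doob_max M F (\<lambda>i y. ?s i y * indicator (fin_set M \<tau>) y) x) p
            * ennreal (v x) \<partial>M) (1 / p)
      \<le> ennreal (C3 * iprod (\<lambda>i. wmeas M (?s i) (fin_set M \<tau>) powr (1 / ps i)))"
      using \<open>stmt3\<close> unfolding stmt3_def S_class_def by blast
    obtain CR where CR: "0 < CR" and R: "\<And>\<tau>. ext_stopping_time F \<tau> \<Longrightarrow>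
        ennreal (iprod (\<lambda>i. (LINT x:fin_set M \<tau>|M. ?s i x) powr (p / ps i)))
      \<le> ennreal CR * (\<integral>\<^sup>+x\<in>fin_set M \<tau>. ennreal (iprod (\<lambda>i. ?s i x powr (p / ps i))) \<partial>M)"
      using RH unfolding RH_def by blast
    obtain B where B: "0 < B" "\<And>N. (\<Prod>i<N. ps i / (ps i - 1)) \<le> B"
      using prod_conj_exp_bounded[OF ps sums_summable[OF ps_sums]] by metis
    let ?C = "C3 powr p * CR"
    note bound = two_weight_bound[OF v_meas _ testing_of_S_class_RH[OF _ C3 CR S R] B]
    show stmt2
      unfolding stmt2_def
    proof (intro exI[of _ "(2 * ?C) powr (1 / p) * B"] conjI allI impI)
      show "0 < (2 * ?C) powr (1 / p) * B" using B C3 CR by simp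
      fix g :: "nat \<Rightarrow> 'a \<Rightarrow> real"
      assume g: "(\<forall>i. g i \<in> Lw M (ps i) (?s i) \<and> (AE x in M. 0 \<le> g i x))
          \<and> iprod_finite (\<lambda>i. Lw_norm M (ps i) (?s i) (g i))"
      show "eLw_norm M p v (doob_max M F (\<lambda>i x. g i x * ?s i x))
          \<le> ennreal ((2 * ?C) powr (1 / p) * B * iprod (\<lambda>i. Lw_norm M (ps i) (?s i) (g i)))"
        by (rule bound) (use g C3 CR in auto)
    qed
  qed
  ultimately show ?thesis by blast
qed

end
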